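(* The group $\widetilde{\Gamma}$ given by the presentation $$\widetilde{\Gamma}=\langle a,b,c,d,t \mid a^2=b^2=bcd=(ad)^4=(adacac)^4=1,\ a^t=aca,\ b^t=d,\ c^t=b,\ d^t=c\rangle$$ is isolated.
   Context: In a group, $x^y=y^{-1}xy$. ($\widetilde{\Gamma}$ is Grigorchuk's finitely presented amenable group.) $F_m$ is the free group of rank $m$, and $\mathcal{G}_m$ is the set of normal subgroups of $F_m$ with the topology induced by the product topology on $\{0,1\}^{F_m}$; a point $N$ represents the marked group $F_m/N$. A group $G$ is isolated if it is finitely generated and, for some $m$ and some normal subgroup $N$ of $F_m$ with $F_m/N\cong G$, the point $N$ is isolated in $\mathcal{G}_m$ (this does not depend on the choice of $m$ and $N$). *)

theory Defs
  imports "HOL-Analysis.Analysis" "HOL-Algebra.Algebra"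
begin

text \<open>A letter \<open>(x, e)\<close> stands for the generator \<open>x\<close> if \<open>e\<close> is \<open>True\<close> and for its formal inverse
  otherwise. The elements of the free group on \<open>S\<close> are the freely reduced words over \<open>S\<close>, and a
  product is formed by prepending the letters of the left factor one at a time.\<close>

definition inv_letter :: "'g \<times> bool \<Rightarrow> 'g \<times> bool" where
  "inv_letter l = (fst l, \<not> snd l)"

definition freely_reduced :: "('g \<times> bool) list \<Rightarrow> bool" where
  "freely_reduced w \<longleftrightarrow> successively (\<lambda>k l. l \<noteq> inv_letter k) w"

definition prepend_letter :: "'g \<times> bool \<Rightarrow> ('g \<times> bool) list \<Rightarrow> ('g \<times> bool) list" where
  "prepend_letter l w =
    (case w of [] \<Rightarrow> [l] | k # w' \<Rightarrow> if k = inv_letter l then w' else l # w)"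

definition free_group :: "'g set \<Rightarrow> ('g \<times> bool) list monoid" where
  "free_group S =
    \<lparr>carrier = {w. fst ` set w \<subseteq> S \<and> freely_reduced w}, mult = foldr prepend_letter, one = []\<rparr>"

definition gen :: "'g \<Rightarrow> ('g \<times> bool) list" where
  "gen x = [(x, True)]"

definition normal_closure :: "('a, 'b) monoid_scheme \<Rightarrow> 'a set \<Rightarrow> 'a set" where
  "normal_closure G R = \<Inter>{N. N \<lhd> G \<and> R \<subseteq> N}"

text \<open>A relation \<open>u = v\<close> is represented by the pair \<open>(u, v)\<close> of elements of the free group.\<close>

definition presented_group ::
  "'g set \<Rightarrow> (('g \<times> bool) list \<times> ('g \<times> bool) list) set \<Rightarrow> ('g \<times> bool) list set monoid" where
  "presented_group S R =
    free_group S Mod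
      normal_closure (free_group S)
        {u \<otimes>\<^bsub>free_group S\<^esub> inv\<^bsub>free_group S\<^esub> v | u v. (u, v) \<in> R}"

text \<open>The topology on the normal subgroups of \<open>G\<close> induced by the product topology on the
  \<open>{0, 1}\<close>-valued functions on \<open>G\<close>, a normal subgroup being identified with its indicator
  function. The restriction makes that function a point of the product space over \<open>carrier G\<close>.\<close>

definition normal_subgroup_topology :: "('a, 'b) monoid_scheme \<Rightarrow> 'a set topology" where
  "normal_subgroup_topology G =
    pullback_topology {N. N \<lhd> G} (\<lambda>N. \<lambda>x \<in> carrier G. x \<in> N)
      (product_topology (\<lambda>_. discrete_topology (UNIV :: bool set)) (carrier G))"

definition marked_groups :: "nat \<Rightarrow> (nat \<times> bool) list set topology" where
  "marked_groups m = normal_subgroup_topology (free_group {..<m})"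

definition finitely_generated_group :: "('a, 'b) monoid_scheme \<Rightarrow> bool" where
  "finitely_generated_group G \<longleftrightarrow>
    group G \<and> (\<exists>A. finite A \<and> A \<subseteq> carrier G \<and> generate G A = carrier G)"

definition isolated_group :: "('a, 'b) monoid_scheme \<Rightarrow> bool" where
  "isolated_group G \<longleftrightarrow>
    finitely_generated_group G \<and>
    (\<exists>m N. N \<lhd> free_group {..<m} \<and> (free_group {..<m} Mod N) \<cong> G \<and>
      openin (marked_groups m) {N})"

datatype grigorchuk_generator = GA | GB | GC | GD | GT

text \<open>The conjugate \<open>x\<^sup>y\<close> is \<open>y\<inverse> x y\<close>.\<close>

definition grigorchuk_relations ::
  "((grigorchuk_generator \<times> bool) list \<times> (grigorchuk_generator \<times> bool) list) set" where
  "grigorchuk_relations =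
    (let F = free_group (UNIV :: grigorchuk_generator set);
         a = gen GA; b = gen GB; c = gen GC; d = gen GD; t = gen GT
     in {(a [^]\<^bsub>F\<^esub> (2::nat), \<one>\<^bsub>F\<^esub>),
         (b [^]\<^bsub>F\<^esub> (2::nat), \<one>\<^bsub>F\<^esub>),
         (b \<otimes>\<^bsub>F\<^esub> c \<otimes>\<^bsub>F\<^esub> d, \<one>\<^bsub>F\<^esub>),
         ((a \<otimes>\<^bsub>F\<^esub> d) [^]\<^bsub>F\<^esub> (4::nat), \<one>\<^bsub>F\<^esub>),
         ((a \<otimes>\<^bsub>F\<^esub> d \<otimes>\<^bsub>F\<^esub> a \<otimes>\<^bsub>F\<^esub> c \<otimes>\<^bsub>F\<^esub> a \<otimes>\<^bsub>F\<^esub> c) [^]\<^bsub>F\<^esub> (4::nat), \<one>\<^bsub>F\<^esub>),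
         (inv\<^bsub>F\<^esub> t \<otimes>\<^bsub>F\<^esub> a \<otimes>\<^bsub>F\<^esub> t, a \<otimes>\<^bsub>F\<^esub> c \<otimes>\<^bsub>F\<^esub> a),
         (inv\<^bsub>F\<^esub> t \<otimes>\<^bsub>F\<^esub> b \<otimes>\<^bsub>F\<^esub> t, d),
         (inv\<^bsub>F\<^esub> t \<otimes>\<^bsub>F\<^esub> c \<otimes>\<^bsub>F\<^esub> t, b),
         (inv\<^bsub>F\<^esub> t \<otimes>\<^bsub>F\<^esub> d \<otimes>\<^bsub>F\<^esub> t, c)})"

definition grigorchuk_fp_group :: "(grigorchuk_generator \<times> bool) list set monoid" where
  "grigorchuk_fp_group = presented_group UNIV grigorchuk_relations"

end

theory Submission
  imports Defs
begin

text \<open>A normal subgroup \<open>N\<close> of a free group is an isolated point as soon as it is the only normal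
  subgroup that contains a certain finite set and avoids another one. Here the finite set to be
  contained consists of the nine relators, and the only element to be avoided is a commutator \<open>z\<close>
  in \<open>a, b, c, d\<close>. That these conditions leave only one normal subgroup is the statement that any
  two groups generated by elements satisfying the relations, with \<open>z\<close> nontrivial in both, have the
  same relations (\<open>word_eval_transfer\<close>). Since \<open>z\<close> is nontrivial in the finitely
  presented group itself (\<open>discriminator_nontrivial\<close>), every nontrivial normal subgroup of it
  contains \<open>z\<close>.

  Words in \<open>a, b, c, d\<close> act on the binary tree as Grigorchuk's group does. Conjugation by \<open>t\<close>
  becomes the substitution \<open>sigma\<close>, and \<open>sigma w\<close> acts as \<open>w\<close> on one half of the tree and as
  \<open>phi w\<close>, an element of a dihedral group of order 8, on the other. Two facts link the action
  on the tree with the relations.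

  First, a word that acts trivially on the tree is a relation in every group satisfying the nine
  relations (\<open>tree_trivial_imp_trivial\<close>). This is the hard half of Lysenok's presentation, and it goes
  by induction on the length. A word fixing both halves of the tree is, by the relations, the
  product of \<open>sigma h\<close> and an element conjugated from \<open>sigma k\<close> by \<open>a\<close>, where \<open>h\<close> is its action on
  one half and \<open>k\<close> is determined by its action on the other (\<open>section_decomposition\<close>). If the word
  acts trivially on the tree then so do its actions on the halves, which are shorter words and thus
  relations by induction, and \<open>h\<close> and \<open>k\<close> are relations as well.

  Second, if \<open>z\<close> is nontrivial in a group satisfying the relations, then a relation
  between \<open>a, b, c, d\<close> acts trivially on the tree (\<open>trivial_imp_tree_trivial\<close>). For if an element \<open>w\<close> moves a
  vertex of the tree and commutes with every element of a suitable normal subgroup, then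
  this subgroup is abelian (\<open>moving_commutes\<close>): descending to the half of the tree in which the vertex
  moves preserves the hypothesis, and an element exchanging the halves carries the copy of the subgroup
  supported on one half to a commuting copy. The commutator \<open>z\<close> is that of two elements of
  this subgroup, and a relation commutes with everything.

  A word in all five generators equals \<open>t\<close> to some power, times a word \<open>h\<close> in \<open>a, b, c, d\<close>, times another power
  of the inverse of \<open>t\<close>. If the exponents agree, the two facts show that it is a relation in one group when it
  is in the other. If they differ and it is a relation, a power of \<open>t\<close> lies in the subgroup generated by
  \<open>a, b, c, d\<close>, so that \<open>a\<close> is conjugate there to an element in the image of \<open>sigma\<close>. This is
  impossible, since \<open>a\<close> exchanges the halves of the tree and such an image does not
  (\<open>ev_ne_ti_funpow\<close>).

  The nontriviality of \<open>z\<close> needs one concrete group satisfying the relations. The tree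
  is embedded as one half of a bigger tree over and over again, \<open>t\<close> shifts the resulting increasing union, and
  \<open>a, b, c, d\<close> act outside the original tree through the dihedral group.\<close>



section \<open>Words in the four involutions\<close>

datatype letter = LA | LB | LC | LD

type_synonym word = "letter list"

fun sigma_letter :: "letter \<Rightarrow> word" where
  "sigma_letter LA = [LA, LC, LA]"
| "sigma_letter LB = [LD]"
| "sigma_letter LC = [LB]"
| "sigma_letter LD = [LC]"

definition sigma :: "word \<Rightarrow> word" where
  "sigma w = concat (map sigma_letter w)"

text \<open>The word \<open>phi w\<close> describes how \<open>sigma w\<close> acts on the left half of the tree. It is a word in \<open>a\<close>
  and \<open>d\<close>, which generate a dihedral group of order 8.\<close>

fun phi_letter :: "letter \<Rightarrow> word" where
  "phi_letter LA = [LD]"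
| "phi_letter LB = []"
| "phi_letter LC = [LA]"
| "phi_letter LD = [LA]"

definition phi :: "word \<Rightarrow> word" where
  "phi w = concat (map phi_letter w)"

lemma sigma_simps [simp]:
  "sigma [] = []" "sigma (l # w) = sigma_letter l @ sigma w" "sigma (u @ v) = sigma u @ sigma v"
  by (simp_all add: sigma_def)

lemma phi_simps [simp]:
  "phi [] = []" "phi (l # w) = phi_letter l @ phi w" "phi (u @ v) = phi u @ phi v"
  by (simp_all add: phi_def)

lemma rev_sigma: "rev (sigma w) = sigma (rev w)"
proof (induction w)
  case (Cons l w)
  then show ?case by (cases l) auto
qed simp

text \<open>A triple \<open>(x, y, z)\<close> is the element \<open>d\<^sup>x (ada)\<^sup>y a\<^sup>z\<close> of the dihedral group of order 8
  generated by involutions \<open>a\<close> and \<open>d\<close> with \<open>(ad)\<^sup>4 = 1\<close>. The function \<open>dih\<close> is the homomorphism with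
  \<open>a \<mapsto> a\<close>, \<open>b \<mapsto> 1\<close>, \<open>c, d \<mapsto> d\<close>, that is, the quotient by the normal closure of \<open>b\<close>. Exchanging the
  letters \<open>a\<close> and \<open>d\<close> turns it into \<open>phi\<close>.\<close>

type_synonym dihedral = "bool \<times> bool \<times> bool"

fun dih_step :: "letter \<Rightarrow> dihedral \<Rightarrow> dihedral" where
  "dih_step LA (x, y, z) = (y, x, \<not> z)"
| "dih_step LB (x, y, z) = (x, y, z)"
| "dih_step LC (x, y, z) = (\<not> x, y, z)"
| "dih_step LD (x, y, z) = (\<not> x, y, z)"

definition dih :: "word \<Rightarrow> dihedral" where
  "dih w = foldr dih_step w (False, False, False)"

abbreviation dih_one :: dihedral where
  "dih_one \<equiv> (False, False, False)"

fun dih_mult :: "dihedral \<Rightarrow> dihedral \<Rightarrow> dihedral" where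
  "dih_mult (p, q, r) (x, y, z) = (if r then (p \<noteq> y, q \<noteq> x, \<not> z) else (p \<noteq> x, q \<noteq> y, z))"

lemma dih_simps [simp]: "dih [] = dih_one" "dih (l # w) = dih_step l (dih w)"
  by (simp_all add: dih_def)

lemma dih_append: "dih (u @ v) = dih_mult (dih u) (dih v)"
proof (induction u)
  case Nil
  then show ?case by (cases "dih v") auto
next
  case (Cons l u)
  then show ?case by (cases l; cases "dih u"; cases "dih v") auto
qed

lemma dih_conj:
  assumes "dih k = dih_one"
  shows "dih (rev u @ k @ u) = dih_one"
proof (induction u)
  case Nil
  then show ?case using assms by simp
next
  case (Cons l u)
  have "dih (rev u @ (l # k @ [l]) @ u) = dih_mult (dih (rev u)) (dih_mult (dih (l # k @ [l])) (dih u))"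
    by (simp only: dih_append)
  also have "dih (l # k @ [l]) = dih k"
    using assms by (cases l) (auto simp: dih_append)
  also have "dih_mult (dih (rev u)) (dih_mult (dih k) (dih u)) = dih (rev u @ k @ u)"
    by (simp only: dih_append)
  finally show ?case using Cons by simp
qed

text \<open>The dihedral group permutes the corners of a square, here from the right: \<open>a\<close> is the reflection
  in a diagonal and \<open>d\<close> one exchanging two opposite sides.\<close>

fun corner_move :: "word \<Rightarrow> bool \<times> bool \<Rightarrow> bool \<times> bool" where
  "corner_move [] v = v"
| "corner_move (LA # h) (p, q) = corner_move h (q, p)"
| "corner_move (LB # h) (p, q) = corner_move h (p, q)"
| "corner_move (LC # h) (p, q) = corner_move h (\<not> p, q)"
| "corner_move (LD # h) (p, q) = corner_move h (\<not> p, q)"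

lemma corner_move_eq:
  "corner_move h (p, q) =
     (case dih h of (x, y, z) \<Rightarrow> if z then (q \<noteq> y, p \<noteq> x) else (p \<noteq> x, q \<noteq> y))"
proof (induction h arbitrary: p q)
  case (Cons l h)
  then show ?case by (cases l; cases "dih h") auto
qed simp

fun parity :: "word \<Rightarrow> bool" where
  "parity [] = False"
| "parity (l # w) = (if l = LA then \<not> parity w else parity w)"

lemma parity_append [simp]: "parity (u @ v) = (parity u \<noteq> parity v)"
  by (induction u) auto

lemma parity_rev [simp]: "parity (rev w) = parity w"
  by (induction w) auto

lemma parity_sigma [simp]: "\<not> parity (sigma w)"
proof (induction w)
  case (Cons l w)
  then show ?case by (cases l) auto
qed simp

section \<open>Sections and the action on the binary tree\<close>

text \<open>The recursion is \<open>b = (a, c)\<close>, \<open>c = (a, d)\<close>, \<open>d = (1, b)\<close>, where \<open>False\<close> denotes the left half of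
  the tree and \<open>True\<close> the right half. Words act from the left, so that the last letter acts first.\<close>

fun letter_section :: "letter \<Rightarrow> bool \<Rightarrow> word" where
  "letter_section LA s = []"
| "letter_section LB s = (if s then [LC] else [LA])"
| "letter_section LC s = (if s then [LD] else [LA])"
| "letter_section LD s = (if s then [LB] else [])"

fun section_at :: "word \<Rightarrow> bool \<Rightarrow> word" where
  "section_at [] s = []"
| "section_at (l # w) s = letter_section l (s \<noteq> parity w) @ section_at w s"

lemma section_at_append: "section_at (u @ v) s = section_at u (s \<noteq> parity v) @ section_at v s"
proof (induction u)
  case (Cons l u)
  then show ?case by (cases "parity u"; cases "parity v"; cases s) auto
qed simp

text \<open>Letters other than \<open>a\<close> contribute at most one letter to a section and \<open>a\<close> contributes none, so the
  sections of a word that contains \<open>a\<close> are strictly shorter.\<close>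

lemma length_section_at: "length (section_at w s) + count_list w LA \<le> length w"
proof (induction w)
  case (Cons l w)
  then show ?case by (cases l) auto
qed simp

fun tree_letter :: "letter \<Rightarrow> bool list \<Rightarrow> bool list" where
  "tree_letter l [] = []"
| "tree_letter LA (s # v) = (\<not> s) # v"
| "tree_letter LB (s # v) = s # tree_letter (if s then LC else LA) v"
| "tree_letter LC (s # v) = s # tree_letter (if s then LD else LA) v"
| "tree_letter LD (s # v) = s # (if s then tree_letter LB v else v)"

definition tree :: "word \<Rightarrow> bool list \<Rightarrow> bool list" where
  "tree w = foldr tree_letter w"

lemma tree_simps [simp]:
  "tree [] v = v" "tree (l # w) v = tree_letter l (tree w v)" "tree (u @ w) v = tree u (tree w v)"
  by (simp_all add: tree_def)

lemma tree_letter_involution [simp]: "tree_letter l (tree_letter l v) = v"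
proof (induction v arbitrary: l)
  case (Cons s v)
  then show ?case by (cases l) auto
qed simp

lemma tree_letter_product [simp]:
  "tree_letter LB (tree_letter LC v) = tree_letter LD v"
  "tree_letter LC (tree_letter LD v) = tree_letter LB v"
  "tree_letter LD (tree_letter LB v) = tree_letter LC v"
  "tree_letter LC (tree_letter LB v) = tree_letter LD v"
  "tree_letter LD (tree_letter LC v) = tree_letter LB v"
  "tree_letter LB (tree_letter LD v) = tree_letter LC v"
  by (induction v) auto

lemma tree_Nil [simp]: "tree w [] = []"
  by (induction w) auto

lemma tree_Cons: "tree w (s # v) = (s \<noteq> parity w) # tree (section_at w s) v"
proof (induction w)
  case (Cons l w)
  then show ?case by (cases l) auto
qed simp

lemma tree_trivial_sections:
  assumes "\<And>v. tree w v = v"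
  shows "\<not> parity w" "tree (section_at w s) v = v"
  using assms[of "s # v"] by (auto simp: tree_Cons)

text \<open>Counting letters modulo 2 in the sections of a word shows that \<open>dih\<close> can be read off from the action on
  the tree.\<close>

fun parity_bc :: "word \<Rightarrow> bool" where
  "parity_bc [] = False"
| "parity_bc (l # w) = (if l = LB \<or> l = LC then \<not> parity_bc w else parity_bc w)"

fun parity_bd :: "word \<Rightarrow> bool" where
  "parity_bd [] = False"
| "parity_bd (l # w) = (if l = LB \<or> l = LD then \<not> parity_bd w else parity_bd w)"

lemma parity_bc_append [simp]: "parity_bc (u @ v) = (parity_bc u \<noteq> parity_bc v)"
  by (induction u) auto

lemma parity_bd_append [simp]: "parity_bd (u @ v) = (parity_bd u \<noteq> parity_bd v)"
  by (induction u) auto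

lemma parity_sections: "(parity (section_at w False) \<noteq> parity (section_at w True)) = parity_bc w"
proof (induction w)
  case (Cons l w)
  then show ?case by (cases l) auto
qed simp

lemma parity_bc_sections:
  "(parity_bc (section_at w False) \<noteq> parity_bc (section_at w True)) = parity_bd w"
proof (induction w)
  case (Cons l w)
  then show ?case by (cases l) auto
qed simp

lemma dih_sections:
  "dih w = (if parity w
     then (parity_bd (section_at w False), parity_bd (section_at w True), True)
     else (parity_bd (section_at w True), parity_bd (section_at w False), False))"
proof (induction w)
  case (Cons l w)
  then show ?case by (cases l) (auto split: if_splits)
qed simp

text \<open>If \<open>w\<close> acts trivially then so do its sections of all levels, whose parities in \<open>a\<close> are therefore
  even. By the counting lemmas this makes two further parities of each section even, and these
  determine the dihedral image of \<open>w\<close>.\<close>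

lemma tree_trivial_dih:
  assumes triv: "\<And>v. tree w v = v"
  shows "dih w = dih_one"
proof -
  have bc: "\<not> parity_bc u" if "\<And>v. tree u v = v" for u
    using parity_sections[of u] tree_trivial_sections(1)[OF tree_trivial_sections(2)[OF that]] by blast
  have bd: "\<not> parity_bd u" if "\<And>v. tree u v = v" for u
    using parity_bc_sections[of u] bc[OF tree_trivial_sections(2)[OF that]] by blast
  show ?thesis
    using bd[OF tree_trivial_sections(2)[OF triv]] tree_trivial_sections(1)[OF triv]
    by (simp add: dih_sections)
qed

section \<open>Words that stay in the kernel of the dihedral quotient\<close>

text \<open>This is the normal subgroup whose elements are used as test elements. It is invariant under the
  substitution, and it lies in the kernel of \<open>dih\<close>, so that \<open>sigma x\<close> acts only on the right half of the
  tree when \<open>x\<close> belongs to it.\<close>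

definition stable_kernel :: "word set" where
  "stable_kernel = {x. \<forall>n. dih ((sigma ^^ n) x) = dih_one}"

lemma sigma_stable_kernel:
  assumes "x \<in> stable_kernel"
  shows "sigma x \<in> stable_kernel"
proof -
  have "dih ((sigma ^^ n) (sigma x)) = dih_one" for n
    using assms unfolding stable_kernel_def mem_Collect_eq
    by (metis comp_apply funpow_Suc_right)
  then show ?thesis by (simp add: stable_kernel_def)
qed

lemma sigma_funpow_append: "(sigma ^^ n) (u @ v) = (sigma ^^ n) u @ (sigma ^^ n) v"
  by (induction n) auto

lemma rev_sigma_funpow: "rev ((sigma ^^ n) u) = (sigma ^^ n) (rev u)"
  by (induction n) (auto simp: rev_sigma)

lemma conj_stable_kernel:
  assumes "x \<in> stable_kernel"
  shows "rev u @ x @ u \<in> stable_kernel"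
  using assms dih_conj unfolding stable_kernel_def by (auto simp: sigma_funpow_append simp flip: rev_sigma_funpow)

lemma dih_stable_kernel: "x \<in> stable_kernel \<Longrightarrow> dih x = dih_one"
  unfolding stable_kernel_def by (auto dest: spec[of _ 0])

text \<open>The dihedral images of the four generators under the iterates of the substitution become periodic with
  period 3 from the second iterate on.\<close>

lemma dih_sigma_funpow_letter:
  "map (\<lambda>l. dih ((sigma ^^ n) [l])) [LA, LB, LC, LD] \<in>
    (let e = dih_one; a = (False, False, True); d = (True, False, False); ada = (False, True, False)
     in {[a, e, d, d], [ada, d, e, d], [e, d, d, e], [d, e, d, d], [d, d, e, d]})"
proof (induction n)
  case 0
  then show ?case by (simp add: Let_def)
next
  case (Suc n)
  let ?e = "\<lambda>l. dih ((sigma ^^ n) [l])"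
  have "dih ((sigma ^^ Suc n) [LA]) = dih_mult (?e LA) (dih_mult (?e LC) (?e LA))"
    using sigma_funpow_append[of n "[LA]" "[LC] @ [LA]"] sigma_funpow_append[of n "[LC]" "[LA]"]
    by (simp add: dih_append funpow_Suc_right del: funpow.simps)
  moreover have "dih ((sigma ^^ Suc n) [LB]) = ?e LD" "dih ((sigma ^^ Suc n) [LC]) = ?e LB"
      "dih ((sigma ^^ Suc n) [LD]) = ?e LC"
    by (simp_all add: funpow_Suc_right del: funpow.simps)
  ultimately show ?case using Suc by (auto simp: Let_def)
qed

text \<open>The words are \<open>(ab)\<^sup>2\<close> and its conjugate by \<open>d\<close>. Their commutator is the element that singles out
  the group.\<close>

definition witness_left :: word where "witness_left = [LA, LB, LA, LB]"
definition witness_right :: word where "witness_right = [LD, LA, LB, LA, LB, LD]"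

lemma dih_sigma_funpow:
  "dih ((sigma ^^ n) w) = foldr (\<lambda>l. dih_mult (dih ((sigma ^^ n) [l]))) w dih_one"
proof (induction w)
  case Nil
  have "(sigma ^^ n) [] = []" by (induction n) auto
  then show ?case by simp
next
  case (Cons l w)
  have "(sigma ^^ n) (l # w) = (sigma ^^ n) [l] @ (sigma ^^ n) w"
    using sigma_funpow_append[of n "[l]" w] by simp
  then show ?case using Cons by (simp add: dih_append)
qed

lemma witnesses_stable: "witness_left \<in> stable_kernel" "witness_right \<in> stable_kernel"
proof -
  have "dih ((sigma ^^ n) witness_left) = dih_one \<and> dih ((sigma ^^ n) witness_right) = dih_one" for n
    using dih_sigma_funpow_letter[of n]
    unfolding dih_sigma_funpow[of n witness_left] dih_sigma_funpow[of n witness_right]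
    by (auto simp: witness_left_def witness_right_def Let_def)
  then show "witness_left \<in> stable_kernel" "witness_right \<in> stable_kernel" by (auto simp: stable_kernel_def)
qed

text \<open>The normal form \<open>(i, h, j)\<close> stands for \<open>t\<^sup>i h s\<^sup>j\<close>. It is computed from the word alone, so that it is the
  same in all groups satisfying the relations. Here \<open>s\<close> is the inverse of \<open>t\<close>.\<close>

fun normal_form :: "(grigorchuk_generator \<times> bool) list \<Rightarrow> nat \<times> word \<times> nat" where
  "normal_form [] = (0, [], 0)"
| "normal_form ((GT, True) # W) = (let (i, h, j) = normal_form W in (Suc i, h, j))"
| "normal_form ((GT, False) # W) =
    (let (i, h, j) = normal_form W in
     if i = 0 then (0, sigma h, Suc j) else (i - 1, h, j))"
| "normal_form ((GA, e) # W) = (let (i, h, j) = normal_form W in (i, (sigma ^^ i) [LA] @ h, j))"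
| "normal_form ((GB, e) # W) = (let (i, h, j) = normal_form W in (i, (sigma ^^ i) [LB] @ h, j))"
| "normal_form ((GC, e) # W) = (let (i, h, j) = normal_form W in (i, (sigma ^^ i) [LC] @ h, j))"
| "normal_form ((GD, e) # W) = (let (i, h, j) = normal_form W in (i, (sigma ^^ i) [LD] @ h, j))"

section \<open>Permutations satisfying the relations\<close>

text \<open>A group satisfying the relations gives such permutations by left multiplication on itself. With
  permutations, calculating in the group amounts to rewriting the terms that apply them to a point.
  The map \<open>ti\<close> is the inverse of \<open>t\<close>.\<close>

locale relation_model =
  fixes a b c d t ti :: "'x \<Rightarrow> 'x"
  assumes aa [simp]: "a (a x) = x"
    and bb [simp]: "b (b x) = x"
    and bcd: "b (c (d x)) = x"
    and ad4: "a (d (a (d (a (d (a (d x))))))) = x"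
    and adacac4: "a (d (a (c (a (c (a (d (a (c (a (c
      (a (d (a (c (a (c (a (d (a (c (a (c x))))))))))))))))))))))) = x"
    and t_ti [simp]: "t (ti x) = x"
    and ti_t [simp]: "ti (t x) = x"
    and conj_a: "ti (a (t x)) = a (c (a x))"
    and conj_b: "ti (b (t x)) = d x"
    and conj_c: "ti (c (t x)) = b x"
    and conj_d: "ti (d (t x)) = c x"
begin

lemma dd [simp]: "d (d x) = x"
  by (metis bb conj_b ti_t t_ti)

lemma cc [simp]: "c (c x) = x"
  by (metis dd conj_d ti_t t_ti)

lemma bc [simp]: "b (c x) = d x" and cb [simp]: "c (b x) = d x"
  and bd [simp]: "b (d x) = c x" and db [simp]: "d (b x) = c x"
  and cd [simp]: "c (d x) = b x" and dc [simp]: "d (c x) = b x"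
  by (metis bcd bb cc dd)+

lemma dada [simp]: "d (a (d (a x))) = a (d (a (d x)))"
  by (metis ad4 aa dd)

text \<open>This is the relation \<open>(ad)\<^sup>4 = 1\<close> conjugated by \<open>t\<close>.\<close>

lemma ac8: "a (c (a (c (a (c (a (c (a (c (a (c (a (c (a (c x))))))))))))))) = x"
proof -
  have "ti (a (t y)) = a (c (a y))" "ti (d (t y)) = c y" for y by (simp_all add: conj_a conj_d)
  then have "a (c (a (c y))) = ti (a (d (t y)))" for y
    by (metis t_ti)
  then show ?thesis
    by (simp add: ad4)
qed

fun generator :: "letter \<Rightarrow> 'x \<Rightarrow> 'x" where
  "generator LA = a" | "generator LB = b" | "generator LC = c" | "generator LD = d"

definition ev :: "word \<Rightarrow> 'x \<Rightarrow> 'x" where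
  "ev w = foldr generator w"

lemma ev_simps [simp]:
  "ev [] x = x" "ev (l # w) x = generator l (ev w x)" "ev (u @ w) x = ev u (ev w x)"
  by (simp_all add: ev_def)

lemma generator_generator [simp]: "generator l (generator l x) = x"
  by (cases l) auto

lemma ev_rev [simp]: "ev w (ev (rev w) x) = x" "ev (rev w) (ev w x) = x"
  by (induction w arbitrary: x) auto

lemma ev_sigma: "ev (sigma w) x = ti (ev w (t x))"
proof (induction w arbitrary: x)
  case (Cons l w)
  have "ev (sigma_letter l) y = ti (generator l (t y))" for y
    by (cases l) (simp_all add: conj_a conj_b conj_c conj_d)
  then show ?case using Cons by simp
qed simp

text \<open>Conjugating \<open>d\<close> by the elements \<open>a (sigma h) a\<close> yields only four elements, which are permuted like the
  corners of a square: the relation \<open>(ac)\<^sup>8 = 1\<close> closes the orbit.\<close>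

fun corner_conjugate :: "bool \<times> bool \<Rightarrow> 'x \<Rightarrow> 'x" where
  "corner_conjugate (False, False) x = d x"
| "corner_conjugate (True, False) x = a (c (a (d (a (c (a x))))))"
| "corner_conjugate (False, True) x = c (a (c (a (d (a (c (a (c x))))))))"
| "corner_conjugate (True, True) x = a (c (a (c (a (c (a (d (a (c (a (c (a (c (a x))))))))))))))"

text \<open>The elements \<open>a (sigma k) a\<close> with \<open>dih k = 1\<close> act only on the left half of
  the tree. The next lemmas derive from the relations that they commute with the elements
  \<open>sigma x\<close> with \<open>dih x = 1\<close>, which act only on the right half.\<close>

definition twisted :: "word \<Rightarrow> 'x \<Rightarrow> 'x" where
  "twisted k x = a (ev (sigma k) (a x))"

lemma twisted_Nil [simp]: "twisted [] x = x"
  and twisted_append [simp]: "twisted (u @ k) x = twisted u (twisted k x)"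
  by (simp_all add: twisted_def)

lemma ac_flip: "a (c (a (c (a (c (a (c x))))))) = c (a (c (a (c (a (c (a x)))))))"
  by (metis aa cc ac8)

lemma adacac_flip:
  "a (d (a (c (a (c (a (d (a (c (a (c x))))))))))) = c (a (c (a (d (a (c (a (c (a (d (a x)))))))))))"
  by (metis aa cc dd adacac4)

lemma corner_c: "corner_conjugate (p, q) (c x) = c (corner_conjugate (q, p) x)"
proof (cases "p \<and> q")
  case True
  have "a (c (a (c (a (c (a (d (a (c (a (c (a (c (a (c x)))))))))))))))
      = a (c (a (c (a (c (a (d (c (a (c (a (c (a (c (a x)))))))))))))))"
    by (simp only: ac_flip)
  also have "\<dots> = a (c (a (c (a (c (a (c (d (a (c (a (c (a (c (a x)))))))))))))))"
    by simp
  also have "\<dots> = c (a (c (a (c (a (c (a (d (a (c (a (c (a (c (a x)))))))))))))))"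
    by (simp only: ac_flip)
  finally show ?thesis using True by (simp del: cd dc)
next
  case False
  then show ?thesis by (cases p; cases q) simp_all
qed

lemma corner_aca:
  "corner_conjugate (p, q) (a (c (a x))) = a (c (a (corner_conjugate (\<not> p, q) x)))"
  by (cases p; cases q) simp_all

text \<open>For the corners \<open>(False, False)\<close> and \<open>(False, True)\<close> these are the relations \<open>(ad)\<^sup>4 = 1\<close> and
  \<open>(adacac)\<^sup>4 = 1\<close>. The other two corners are obtained from them by conjugation with \<open>aca\<close>, which
  commutes with \<open>ada\<close>.\<close>

lemma corner_ada: "corner_conjugate v (a (d (a x))) = a (d (a (corner_conjugate v x)))"
proof -
  have aca_ada: "a (c (a (a (d (a y))))) = a (d (a (a (c (a y)))))" for y by simp
  have base: "corner_conjugate (False, q) (a (d (a y))) = a (d (a (corner_conjugate (False, q) y)))"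
    for q y by (cases q) (simp_all add: adacac_flip del: cd dc)
  have "corner_conjugate (True, q) y = a (c (a (corner_conjugate (False, q) (a (c (a y))))))" for q y
    by (cases q) simp_all
  then have "corner_conjugate (True, q) (a (d (a y))) = a (d (a (corner_conjugate (True, q) y)))"
    for q y by (simp only: aca_ada base)
  with base show ?thesis by (metis prod.exhaust)
qed

lemma corner_twisted: "corner_conjugate v (twisted h x) = twisted h (corner_conjugate (corner_move h v) x)"
proof (induction h arbitrary: v x)
  case (Cons l h)
  obtain p q where v: "v = (p, q)" by (cases v)
  have aba: "a (b (a y)) = a (c (a (a (d (a y)))))" for y by simp
  have "twisted (l # h) y = twisted [l] (twisted h y)" for y
    using twisted_append[of "[l]" h] by simp
  moreover have "corner_conjugate (p, q) (twisted [l] y) = twisted [l] (corner_conjugate (corner_move [l] (p, q)) y)" for y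
  proof (cases l)
    case LC
    show ?thesis unfolding LC twisted_def
      by (simp add: aba corner_aca corner_ada del: cd aa) 
  qed (simp_all add: twisted_def corner_c corner_aca corner_ada)
  moreover have "corner_move (l # h) v = corner_move h (corner_move [l] v)"
    using v by (cases l) auto
  ultimately show ?case using Cons v by simp
qed simp

lemma d_twisted:
  assumes "dih k = dih_one"
  shows "d (twisted k x) = twisted k (d x)"
  using corner_twisted[of "(False, False)" k x] assms by (simp add: corner_move_eq)

text \<open>The letters of \<open>sigma x\<close> act on the left half of the tree by \<open>phi x\<close>, so conjugation by \<open>sigma x\<close> should
  amount to conjugating \<open>k\<close> by \<open>phi x\<close>. Letter by letter this follows because \<open>d\<close> commutes
  with these elements and \<open>aca\<close> and \<open>c\<close> are \<open>a (sigma d) a\<close> and \<open>a (sigma a) a\<close>.\<close>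

lemma twisted_sigma:
  assumes "dih k = dih_one"
  shows "twisted k (ev (sigma x) v) = ev (sigma x) (twisted (rev (phi x) @ k @ phi x) v)"
  using assms
proof (induction x arbitrary: k v)
  case (Cons l x)
  have "twisted k (ev (sigma_letter l) y) =
      ev (sigma_letter l) (twisted (rev (phi_letter l) @ k @ phi_letter l) y)" for y
  proof (cases l)
    case LC
    have "b (twisted k' y) = d (c (twisted k' y))" for k' by simp
    then show ?thesis using d_twisted[OF Cons.prems] unfolding LC
      by (simp add: twisted_def flip: d_twisted)
  qed (use d_twisted[OF Cons.prems] in \<open>simp_all add: twisted_def\<close>)
  moreover have "dih (rev (phi_letter l) @ k @ phi_letter l) = dih_one"
    using Cons.prems by (rule dih_conj)
  ultimately show ?case using Cons.IH by (simp del: twisted_append)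
qed simp

text \<open>An element fixing the halves of the tree acts on the right half by \<open>h\<close> and on the left half by \<open>phi h\<close> times
  a correction \<open>k\<close>. The relations alone imply that it is the product of \<open>sigma h\<close> and of \<open>k\<close> transported to the
  left half, so that it is determined by its two sections.\<close>

lemma section_decomposition:
  obtains k where "dih k = dih_one"
    "\<And>v. ev w v = (if parity w then a else id) (ev (sigma (section_at w True)) (twisted k v))"
    "\<And>v. ev (section_at w False) v = ev (phi (section_at w True)) (ev k v)"
proof -
  have "\<exists>k. dih k = dih_one \<and>
    (\<forall>v. ev w v = (if parity w then a else id) (ev (sigma (section_at w True)) (twisted k v))) \<and>
    (\<forall>v. ev (section_at w False) v = ev (phi (section_at w True)) (ev k v))"
  proof (induction w)
    case (Cons l w)
    let ?h = "section_at w True"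
    from Cons obtain k where k: "dih k = dih_one"
      and w: "\<And>v. ev w v = (if parity w then a else id) (ev (sigma ?h) (twisted k v))"
      and w0: "\<And>v. ev (section_at w False) v = ev (phi ?h) (ev k v)" by blast
    show ?case
    proof (cases "parity w \<and> (l = LB \<or> l = LD)")
      case True
      \<comment> \<open>Here \<open>aba\<close> is \<open>aca\<close> times \<open>ada\<close>, and \<open>ada\<close> is the copy of \<open>b\<close> on the left half. Moved past \<open>sigma h\<close> it becomes the copy of a conjugate of \<open>b\<close>.\<close>
      define m where "m = rev (phi ?h) @ [LB] @ phi ?h"
      have m: "dih m = dih_one"
        unfolding m_def by (rule dih_conj) simp
      have ev_m: "ev (phi ?h) (ev m v) = b (ev (phi ?h) v)" for v
        by (simp add: m_def)
      have "a (d (a (ev (sigma ?h) v))) = ev (sigma ?h) (twisted m v)" for v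
        using twisted_sigma[of "[LB]" ?h v] by (simp add: twisted_def m_def)
      then have d: "d (a (ev (sigma ?h) v)) = a (ev (sigma ?h) (twisted m v))" for v
        by (metis aa)
      have b: "b (a (ev (sigma ?h) v)) = c (a (ev (sigma ?h) (twisted m v)))" for v
        using cd[of "a (ev (sigma ?h) v)"] unfolding d by simp
      have "dih (m @ k) = dih_one" using m k by (simp add: dih_append)
      with True show ?thesis
        by (intro exI[of _ "m @ k"]) (elim conjE disjE; simp add: w w0 b d ev_m)
    next
      case False
      then show ?thesis using k w w0 by (intro exI[of _ k]) (cases l; auto)
    qed
  next
    case Nil
    show ?case by (rule exI[of _ "[]"]) simp
  qed
  then show ?thesis using that by blast
qed

text \<open>The value is \<open>dih w\<close> with \<open>a\<close> and \<open>d\<close> exchanged; \<open>a\<close> and \<open>d\<close> satisfy the relations of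
  the dihedral group in every model.\<close>

lemma ev_phi: "dih w = (x, y, z) \<Longrightarrow>
    ev (phi w) v = (if x then a else id) ((if y then d \<circ> a \<circ> d else id) ((if z then d else id) v))"
proof (induction w arbitrary: x y z)
  case (Cons l w)
  obtain x' y' z' where w: "dih w = (x', y', z')" by (cases "dih w")
  show ?case using Cons.prems Cons.IH[OF w] w by (cases l) auto
qed simp

section \<open>Words acting trivially on the tree are relations\<close>

text \<open>Without \<open>a\<close> the word lies in the Klein four-group of \<open>b, c, d\<close>, which acts faithfully on the tree.\<close>

lemma trivial_without_LA:
  assumes "LA \<notin> set w" and "\<And>v. tree w v = v"
  shows "ev w x = x"
proof -
  \<comment> \<open>Adjacent letters \<open>b, c, d\<close> multiply to one letter or cancel, in the model as on the tree.\<close>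
  have "\<exists>u \<in> {[], [LB], [LC], [LD]}. ev w = ev u \<and> tree w = tree u"
    using assms(1)
  proof (induction w)
    case (Cons l w)
    then obtain u where "u \<in> {[], [LB], [LC], [LD]}" "ev w = ev u" "tree w = tree u" by auto
    then show ?case using Cons.prems by (cases l) (auto simp: fun_eq_iff)
  qed simp
  then obtain u where u: "u \<in> {[], [LB], [LC], [LD]}" "ev w = ev u" "tree w = tree u" by blast
  then have "tree u [False, False] = [False, False]" "tree u [True, False, False] = [True, False, False]"
    using assms(2) by metis+
  then show ?thesis using u by auto
qed

text \<open>The sections act trivially, hence are relations by induction. Then the correction \<open>k\<close> of the decomposition is
  a relation provided \<open>phi\<close> of the right section is one. That does not follow from the right section
  being a relation, as \<open>phi\<close> is a map on words; but the right section acts trivially on the tree, so its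
  dihedral image is trivial.\<close>

theorem tree_trivial_imp_trivial:
  assumes "\<And>v. tree w v = v"
  shows "ev w x = x"
  using assms
proof (induction "length w" arbitrary: w x rule: less_induct)
  case less
  show ?case
  proof (cases "LA \<in> set w")
    case True
    then have "count_list w LA \<noteq> 0" by (simp add: count_list_0_iff)
    then have "length (section_at w s) < length w" for s
      using length_section_at[of w s] by linarith
    then have sec: "ev (section_at w s) v = v" for s v
      using less tree_trivial_sections(2) by blast
    obtain k where k: "dih k = dih_one"
      "\<And>v. ev w v = (if parity w then a else id) (ev (sigma (section_at w True)) (twisted k v))"
      "\<And>v. ev (section_at w False) v = ev (phi (section_at w True)) (ev k v)"
      using section_decomposition[of w] by metis
    have "dih (section_at w True) = dih_one"
      using less.prems by (intro tree_trivial_dih tree_trivial_sections(2))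
    then have "ev k v = v" for v
      using k(3)[of v] ev_phi[of "section_at w True" False False False] sec by simp
    then have "twisted k v = v" for v
      by (simp add: twisted_def ev_sigma)
    moreover have "ev (sigma (section_at w True)) v = v" for v
      using sec by (simp add: ev_sigma)
    ultimately show ?thesis
      using k(2) tree_trivial_sections(1)[OF less.prems] by simp
  next
    case False
    then show ?thesis using less.prems by (rule trivial_without_LA)
  qed
qed

section \<open>Relations act trivially on the tree\<close>

lemma twisted_rev: "twisted (rev u) (twisted u v) = v" "twisted u (twisted (rev u) v) = v"
  by (simp_all add: twisted_def flip: rev_sigma)

lemma twisted_commutes_sigma:
  assumes "dih k = dih_one" "dih x = dih_one"
  shows "twisted k (ev (sigma x) v) = ev (sigma x) (twisted k v)"
proof -
  have "twisted (phi x) v = v" for v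
    using ev_phi[OF assms(2)] by (simp add: twisted_def ev_sigma)
  moreover from this have "twisted (rev (phi x)) v = v" for v
    by (metis twisted_rev(1))
  ultimately show ?thesis by (simp add: twisted_sigma[OF assms(1)])
qed

text \<open>The hypothesis on \<open>w\<close> asks only for commutation with the test elements, since this, unlike \<open>w = 1\<close>,
  passes to the section in which a vertex moves. If \<open>w\<close> exchanges the halves of the tree, then it carries
  the right copy \<open>sigma x\<close> of a test element to an element acting on the left half only. As \<open>w\<close> commutes with
  \<open>sigma x\<close>, that element is \<open>sigma x\<close> itself, which therefore commutes with all right copies \<open>sigma y\<close>.\<close>

lemma moving_commutes:
  assumes "tree w v \<noteq> v"
    and "\<And>x p. x \<in> stable_kernel \<Longrightarrow> ev w (ev x p) = ev x (ev w p)"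
    and "x \<in> stable_kernel" "y \<in> stable_kernel"
  shows "ev x (ev y p) = ev y (ev x p)"
  using assms
proof (induction v arbitrary: w)
  case Nil
  then show ?case by simp
next
  case (Cons s v)
  have descend: ?case if w: "\<not> parity w" "tree (section_at w True) v \<noteq> v"
      "\<And>x p. x \<in> stable_kernel \<Longrightarrow> ev w (ev x p) = ev x (ev w p)" for w
  proof (rule Cons.IH[OF w(2) _ Cons.prems(3,4)])
    fix x p assume x: "x \<in> stable_kernel"
    obtain k where k: "dih k = dih_one"
      "\<And>v. ev w v = (if parity w then a else id) (ev (sigma (section_at w True)) (twisted k v))"
      using section_decomposition[of w] by metis
    let ?h = "section_at w True"
    have tk: "twisted k (ev (sigma x) q) = ev (sigma x) (twisted k q)" for q
      using k(1) dih_stable_kernel[OF x] by (rule twisted_commutes_sigma)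
    have "ev (sigma ?h) (ev (sigma x) (twisted k q)) = ev (sigma x) (ev (sigma ?h) (twisted k q))" for q
      using w(3)[OF sigma_stable_kernel[OF x], of q] w(1) by (simp add: k(2) tk)
    moreover have "\<exists>q. twisted k q = r" for r
      by (metis twisted_rev(2))
    ultimately have "ev (sigma ?h) (ev (sigma x) q) = ev (sigma x) (ev (sigma ?h) q)" for q
      by metis
    from this[of "ti p"] show "ev ?h (ev x p) = ev x (ev ?h p)"
      by (metis ev_sigma t_ti)
  qed
  show ?case
  proof (cases "parity w")
    case False
    show ?thesis
    proof (cases s)
      case True
      then show ?thesis using Cons.prems False by (intro descend[of w]) (auto simp: tree_Cons)
    next
      case s: False
      have "ev (LA # w @ [LA]) (ev x p) = ev x (ev (LA # w @ [LA]) p)" if "x \<in> stable_kernel" for x p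
        using Cons.prems(2)[OF conj_stable_kernel[OF that, of "[LA]"], of "a p"] by simp
      then show ?thesis using Cons.prems(1) False s
        by (intro descend[of "LA # w @ [LA]"]) (auto simp: tree_Cons section_at_append)
    qed
  next
    case True
    define w' where "w' = w @ [LA]"
    have w': "\<not> parity w'" "\<And>p. ev w p = ev w' (a p)" using True by (auto simp: w'_def)
    obtain k where k: "dih k = dih_one"
      "\<And>v. ev w' v = (if parity w' then a else id) (ev (sigma (section_at w' True)) (twisted k v))"
      using section_decomposition[of w'] by metis
    let ?h = "section_at w' True"
    let ?u = "rev k @ rev (phi ?h)"
    \<comment> \<open>As \<open>w\<close> exchanges the halves of the tree, commuting with it makes \<open>sigma x\<close> equal to a conjugate of \<open>x\<close> transported to the left half.\<close>
    let ?m = "rev ?u @ x @ ?u"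
    have m: "dih ?m = dih_one"
      using dih_conj dih_stable_kernel[OF Cons.prems(3)] .
    have "ev (sigma x) q = twisted ?m q" for q
    proof -
      obtain r where r: "q = ev (sigma ?h) (twisted k (a r))"
        by (metis aa ev_rev(1) twisted_rev(2))
      have "ev (sigma x) q = ev w (ev (sigma x) r)"
        using Cons.prems(2)[OF sigma_stable_kernel[OF Cons.prems(3)], of r] w' k(2) r by simp
      also have "\<dots> = ev (sigma ?h) (twisted k (twisted x (a r)))"
        using w' k(2) by (simp add: twisted_def)
      also have "\<dots> = twisted ?m q"
        unfolding r twisted_sigma[OF m] by (simp add: twisted_rev)
      finally show ?thesis .
    qed
    then have "ev (sigma x) (ev (sigma y) q) = ev (sigma y) (ev (sigma x) q)" for q
      using twisted_commutes_sigma[OF m dih_stable_kernel[OF Cons.prems(4)]] by simp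
    from this[of "ti p"] show ?thesis
      by (metis ev_sigma t_ti)
  qed
qed


lemma trivial_imp_tree_trivial:
  assumes "ev (witness_left @ witness_right) \<noteq> ev (witness_right @ witness_left)" and "\<And>p. ev w p = p"
  shows "tree w v = v"
  using moving_commutes[of w v witness_left witness_right] witnesses_stable assms by (auto simp: fun_eq_iff)

section \<open>Transfer of relations between models\<close>

lemma ev_sigma_funpow: "ev ((sigma ^^ n) w) x = (ti ^^ n) (ev w ((t ^^ n) x))"
  by (induction n arbitrary: x) (simp_all add: ev_sigma funpow_swap1[of t])

lemma ti_t_funpow [simp]: "(ti ^^ n) ((t ^^ n) x) = x" "(t ^^ n) ((ti ^^ n) x) = x"
proof (induction n arbitrary: x)
  case (Suc n)
  { case 1 show ?case using Suc by (simp add: funpow_swap1[of t]) }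
  { case 2 show ?case using Suc by (simp add: funpow_swap1[of ti]) }
qed auto

text \<open>If \<open>g\<close> were the inverse of \<open>t\<^sup>m\<close>, then conjugation by \<open>g\<close> would carry \<open>a\<close> to its image under the
  \<open>m\<close>-th iterate of the substitution. But the resulting relation exchanges the halves of the tree.\<close>

lemma ev_ne_ti_funpow:
  assumes "ev (witness_left @ witness_right) \<noteq> ev (witness_right @ witness_left)" and "m > 0"
  shows "ev g \<noteq> ti ^^ m"
proof
  assume g: "ev g = ti ^^ m"
  let ?w = "(sigma ^^ m) [LA] @ g @ [LA] @ rev g"
  have rg: "ev (rev g) x = (t ^^ m) x" for x
    by (metis ev_rev(2) g ti_t_funpow(2))
  have "ev ?w p = p" for p
    by (simp add: ev_sigma_funpow g rg)
  then have "tree ?w v = v" for v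
    using trivial_imp_tree_trivial[OF assms(1)] by blast
  then have "\<not> parity ?w" by (rule tree_trivial_sections)
  moreover obtain m' where "m = Suc m'" using assms(2) gr0_conv_Suc by blast
  ultimately show False by simp
qed

fun generator_action :: "grigorchuk_generator \<times> bool \<Rightarrow> 'x \<Rightarrow> 'x" where
  "generator_action (GA, e) = a"
| "generator_action (GB, e) = b"
| "generator_action (GC, e) = c"
| "generator_action (GD, e) = d"
| "generator_action (GT, e) = (if e then t else ti)"

definition act :: "(grigorchuk_generator \<times> bool) list \<Rightarrow> 'x \<Rightarrow> 'x" where
  "act W = foldr generator_action W"

lemma act_simps [simp]: "act [] x = x" "act (l # W) x = generator_action l (act W x)"
  "act (V @ W) x = act V (act W x)"
  by (simp_all add: act_def)

lemma act_normal_form: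
  "normal_form W = (i, h, j) \<Longrightarrow> act W x = (t ^^ i) (ev h ((ti ^^ j) x))"
proof (induction W arbitrary: i h j rule: normal_form.induct)
  case (3 W)
  obtain i' h' j' where nf: "normal_form W = (i', h', j')" by (cases "normal_form W")
  show ?case using 3 nf
    by (cases i') (auto simp: ev_sigma)
qed (auto split: prod.splits simp: ev_sigma_funpow)

text \<open>In the first model the witnesses force the power of \<open>t\<close> to vanish and the remaining word to act trivially
  on the tree. Such a word is a relation in the second model as well.\<close>

theorem trivial_transfer:
  assumes ne: "ev (witness_left @ witness_right) \<noteq> ev (witness_right @ witness_left)" and triv: "\<And>x. act W x = x"
    and model: "relation_model a' b' c' d' t' ti'"
  shows "relation_model.act a' b' c' d' t' ti' W y = y"
proof -
  interpret M: relation_model a' b' c' d' t' ti' by (rule model)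
  obtain i h j where nf: "normal_form W = (i, h, j)" by (cases "normal_form W")
  have h: "ev h x = (ti ^^ i) ((t ^^ j) x)" for x
    using triv[of "(t ^^ j) x"] act_normal_form[OF nf, of "(t ^^ j) x"] by (metis ti_t_funpow(1))
  consider "i = j" | m where "i = m + j" "m > 0" | m where "j = m + i" "m > 0"
    by (metis add.commute less_imp_add_positive linorder_neqE_nat)
  then show ?thesis
  proof cases
    case 1
    then have "ev h x = x" for x using h by simp
    then have "tree h v = v" for v
      using trivial_imp_tree_trivial[OF ne] by blast
    then show ?thesis
      using M.act_normal_form[OF nf] M.tree_trivial_imp_trivial[of h] 1 by simp
  next
    case 2
    then have "ev h = ti ^^ m" by (auto simp: h funpow_add)
    then show ?thesis using ev_ne_ti_funpow[OF ne 2(2)] by blast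
  next
    case (3 m)
    then have "ev h x = (t ^^ m) x" for x
      unfolding h using funpow_add[of i m t] by (simp add: add.commute)
    then have "ev (rev h) = ti ^^ m"
      by (metis ev_rev(2) ti_t_funpow(2) ext)
    then show ?thesis using ev_ne_ti_funpow[OF ne 3(2)] by blast
  qed
qed

end

section \<open>A model in which the witnesses do not commute\<close>

text \<open>Identifying the binary tree with the right half of a bigger tree, repeatedly, yields an increasing union. \<open>In v\<close>
  is a vertex of the original tree, \<open>Out n v\<close> a vertex in the left half that the step numbered \<open>n\<close> adds, and
  \<open>Top n\<close> the root that this step adds. The permutation \<open>shift\<close> moves every tree of the sequence to the next.
  It turns \<open>sigma w\<close>, which is \<open>phi w\<close> on the left half and \<open>w\<close> on the right half, into \<open>w\<close>, and this dictates
  the action on \<open>Out n v\<close>.\<close>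

datatype extended_vertex = In "bool list" | Out nat "bool list" | Top nat

fun shift :: "extended_vertex \<Rightarrow> extended_vertex" where
  "shift (In []) = Top 0"
| "shift (In (s # v)) = (if s then In v else Out 0 v)"
| "shift (Out n v) = Out (Suc n) v"
| "shift (Top n) = Top (Suc n)"

fun unshift :: "extended_vertex \<Rightarrow> extended_vertex" where
  "unshift (In v) = In (True # v)"
| "unshift (Out 0 v) = In (False # v)"
| "unshift (Out (Suc n) v) = Out n v"
| "unshift (Top 0) = In []"
| "unshift (Top (Suc n)) = Top n"

fun extended_word :: "word \<Rightarrow> extended_vertex \<Rightarrow> extended_vertex" where
  "extended_word w (In v) = In (tree w v)"
| "extended_word w (Out n v) = Out n (tree (phi ((sigma ^^ n) w)) v)"
| "extended_word w (Top n) = Top n"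

lemma tree_sigma: "tree (sigma w) (s # v) = s # tree (if s then w else phi w) v"
proof (induction w arbitrary: v)
  case (Cons l w)
  then show ?case by (cases l; cases s) simp_all
qed simp

lemma extended_word_append: "extended_word (u @ v) p = extended_word u (extended_word v p)"
  by (cases p) (simp_all add: sigma_funpow_append)

lemma unshift_extended_word_shift: "unshift (extended_word w (shift p)) = extended_word (sigma w) p"
proof (cases p)
  case (In v)
  then show ?thesis by (cases v) (auto simp: tree_sigma)
qed (simp_all add: funpow_swap1)

lemma tree_phi:
  "dih w = (x, y, z) \<Longrightarrow> tree (phi w) v =
    tree ((if x then [LA] else []) @ (if y then [LD, LA, LD] else []) @ (if z then [LD] else [])) v"
proof (induction w arbitrary: x y z)
  case (Cons l w)
  obtain x' y' z' where w: "dih w = (x', y', z')" by (cases "dih w")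
  have dada: "tree_letter LD (tree_letter LA (tree_letter LD (tree_letter LA u))) =
       tree_letter LA (tree_letter LD (tree_letter LA (tree_letter LD u)))" for u
    by (cases u) simp_all
  show ?case using Cons.prems Cons.IH[OF w] w by (cases l) (auto simp: dada)
qed simp

text \<open>Outside the original tree the action factors through the dihedral images of the iterated substitutions.\<close>

lemma extended_word_relator:
  assumes "\<And>v. tree r v = v" and "r \<in> stable_kernel"
  shows "extended_word r p = p"
proof (cases p)
  case (Out n v)
  have "dih ((sigma ^^ n) r) = dih_one" using assms(2) by (simp add: stable_kernel_def)
  from tree_phi[OF this] show ?thesis using Out by simp
qed (use assms in simp_all)

interpretation extended: relation_model "extended_word [LA]" "extended_word [LB]" "extended_word [LC]" "extended_word [LD]" shift unshift
proof
  have relator: "extended_word r p = p"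
    if "r \<in> {[LA, LA], [LB, LB], [LB, LC, LD], concat (replicate 4 [LA, LD]),
                concat (replicate 4 [LA, LD, LA, LC, LA, LC])}" for r p
  proof (rule extended_word_relator)
    have "tree r (s # v) = s # v" for s v using that by (cases s) (auto simp: numeral_eq_Suc)
    then show "tree r v = v" for v by (cases v) simp_all
    have "dih ((sigma ^^ n) r) = dih_one" for n
      using dih_sigma_funpow_letter[of n] that unfolding dih_sigma_funpow[of n r]
      by (auto simp: Let_def numeral_eq_Suc)
    then show "r \<in> stable_kernel" by (simp add: stable_kernel_def)
  qed
  fix x
  show "extended_word [LA] (extended_word [LA] x) = x" "extended_word [LB] (extended_word [LB] x) = x"
      "extended_word [LB] (extended_word [LC] (extended_word [LD] x)) = x"
    using relator[of "[LA, LA]" x] relator[of "[LB, LB]" x] relator[of "[LB, LC, LD]" x]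
    by (simp_all flip: extended_word_append)
  show "extended_word [LA] (extended_word [LD] (extended_word [LA] (extended_word [LD] (extended_word [LA] (extended_word [LD] (extended_word [LA] (extended_word [LD] x))))))) = x"
    using relator[of "concat (replicate 4 [LA, LD])" x]
    by (simp add: numeral_eq_Suc flip: extended_word_append)
  show "extended_word [LA] (extended_word [LD] (extended_word [LA] (extended_word [LC] (extended_word [LA] (extended_word [LC]
       (extended_word [LA] (extended_word [LD] (extended_word [LA] (extended_word [LC] (extended_word [LA] (extended_word [LC]
       (extended_word [LA] (extended_word [LD] (extended_word [LA] (extended_word [LC] (extended_word [LA] (extended_word [LC]
       (extended_word [LA] (extended_word [LD] (extended_word [LA] (extended_word [LC] (extended_word [LA] (extended_word [LC] x))))))))))))))))))))))) = x"
    using relator[of "concat (replicate 4 [LA, LD, LA, LC, LA, LC])" x]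
    by (simp add: numeral_eq_Suc flip: extended_word_append)
  show "shift (unshift x) = x" by (cases x rule: unshift.cases) simp_all
  show "unshift (shift x) = x" by (cases x rule: shift.cases) simp_all
qed (simp_all add: unshift_extended_word_shift flip: extended_word_append)

text \<open>On the right half of the tree the witnesses act by \<open>ac\<close> and \<open>bacb\<close>, and these do not commute.\<close>

lemma extended_witnesses: "extended.ev (witness_left @ witness_right) \<noteq> extended.ev (witness_right @ witness_left)"
proof -
  have "extended.ev w (In v) = In (tree w v)" for w v
  proof (induction w)
    case (Cons l w)
    then show ?case by (cases l) simp_all
  qed simp
  moreover have "tree (witness_left @ witness_right) [True, False, False, False]
      \<noteq> tree (witness_right @ witness_left) [True, False, False, False]"
    by (simp add: witness_left_def witness_right_def)
  ultimately have "extended.ev (witness_left @ witness_right) (In [True, False, False, False])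
      \<noteq> extended.ev (witness_right @ witness_left) (In [True, False, False, False])"
    by (simp del: tree_simps extended.ev_simps)
  then show ?thesis by (auto simp del: extended.ev_simps)
qed


section \<open>Free groups and evaluation of words\<close>

lemma inv_letter_inv_letter [simp]: "inv_letter (inv_letter l) = l"
  by (simp add: inv_letter_def)

lemma fst_inv_letter [simp]: "fst (inv_letter l) = fst l"
  by (simp add: inv_letter_def)

lemma freely_reduced_Nil [simp]: "freely_reduced []"
  by (simp add: freely_reduced_def)

lemma freely_reduced_Cons:
  "freely_reduced (l # w) \<longleftrightarrow> (w = [] \<or> hd w \<noteq> inv_letter l) \<and> freely_reduced w"
  by (auto simp: freely_reduced_def successively_Cons)

lemma prepend_letter_Nil [simp]: "prepend_letter l [] = [l]"
  and prepend_letter_Cons: "prepend_letter l (k # w) = (if k = inv_letter l then w else l # k # w)"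
  by (simp_all add: prepend_letter_def)

lemma prepend_letter_reduced: "freely_reduced (l # w) \<Longrightarrow> prepend_letter l w = l # w"
  by (cases w) (auto simp: prepend_letter_Cons freely_reduced_Cons)

lemma freely_reduced_prepend_letter:
  "freely_reduced w \<Longrightarrow> freely_reduced (prepend_letter l w)"
  by (cases w) (auto simp: prepend_letter_Cons freely_reduced_Cons)

text \<open>Prepending a letter permutes the reduced words, the inverse permutation being to prepend the inverse
  letter. Associativity and inverses in the free group follow from this.\<close>

lemma prepend_letter_cancel:
  "freely_reduced w \<Longrightarrow> prepend_letter (inv_letter l) (prepend_letter l w) = w"
  by (cases w; cases "tl w") (auto simp: prepend_letter_Cons freely_reduced_Cons)

lemma freely_reduced_foldr: "freely_reduced w \<Longrightarrow> freely_reduced (foldr prepend_letter u w)"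
  by (induction u) (auto intro: freely_reduced_prepend_letter)

lemma foldr_prepend_prepend:
  assumes "freely_reduced w"
  shows "foldr prepend_letter (prepend_letter l v) w = prepend_letter l (foldr prepend_letter v w)"
  using prepend_letter_cancel[OF freely_reduced_foldr[OF assms], of "inv_letter l"]
  by (cases v) (auto simp: prepend_letter_Cons)

lemma foldr_prepend_assoc:
  assumes "freely_reduced w"
  shows "foldr prepend_letter (foldr prepend_letter u v) w = foldr prepend_letter u (foldr prepend_letter v w)"
  by (induction u) (simp_all add: foldr_prepend_prepend[OF assms])

lemma set_prepend_letter: "fst ` set (prepend_letter l w) \<subseteq> insert (fst l) (fst ` set w)"
  by (cases w) (auto simp: prepend_letter_Cons)

lemma set_foldr_prepend: "fst ` set (foldr prepend_letter u w) \<subseteq> fst ` set u \<union> fst ` set w"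
proof (induction u)
  case (Cons l u)
  have "fst ` set (prepend_letter l (foldr prepend_letter u w))
      \<subseteq> insert (fst l) (fst ` set (foldr prepend_letter u w))"
    by (rule set_prepend_letter)
  also have "\<dots> \<subseteq> insert (fst l) (fst ` set u \<union> fst ` set w)"
    using Cons by (rule insert_mono)
  finally show ?case by simp
qed simp

definition inv_word :: "('g \<times> bool) list \<Rightarrow> ('g \<times> bool) list" where
  "inv_word w = rev (map inv_letter w)"

lemma inv_word_simps [simp]: "inv_word [] = []" "inv_word (l # w) = inv_word w @ [inv_letter l]"
  by (simp_all add: inv_word_def)

lemma freely_reduced_inv_word:
  assumes "freely_reduced w"
  shows "freely_reduced (inv_word w)"
proof -
  have "(l \<noteq> inv_letter k) = (inv_letter k \<noteq> inv_letter (inv_letter l))" for k l :: "'a \<times> bool"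
    by auto
  then have "successively (\<lambda>k l. inv_letter k \<noteq> inv_letter (inv_letter l)) w"
    using assms unfolding freely_reduced_def by simp
  then show ?thesis
    by (simp add: freely_reduced_def inv_word_def successively_map)
qed

lemma foldr_prepend_inv_word: "freely_reduced w \<Longrightarrow> foldr prepend_letter (inv_word w) w = []"
proof (induction w)
  case (Cons l w)
  then have "foldr prepend_letter (inv_word (l # w)) (l # w)
      = foldr prepend_letter (inv_word w) w"
    by (simp add: prepend_letter_Cons)
  with Cons show ?case by (simp add: freely_reduced_Cons)
qed simp

lemma set_inv_word [simp]: "fst ` set (inv_word w) = fst ` set w"
  by (simp add: inv_word_def image_image)

lemma free_group_simps [simp]:
  "w \<in> carrier (free_group S) \<longleftrightarrow> fst ` set w \<subseteq> S \<and> freely_reduced w"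
  "u \<otimes>\<^bsub>free_group S\<^esub> v = foldr prepend_letter u v"
  "\<one>\<^bsub>free_group S\<^esub> = []"
  by (simp_all add: free_group_def)

lemma group_free_group: "group (free_group S)"
proof (rule groupI)
  fix u v w assume u: "u \<in> carrier (free_group S)" and v: "v \<in> carrier (free_group S)"
    and w: "w \<in> carrier (free_group S)"
  show "u \<otimes>\<^bsub>free_group S\<^esub> v \<in> carrier (free_group S)"
    using u v order_trans[OF set_foldr_prepend[of u v], of S]
    by (simp add: freely_reduced_foldr)
  show "u \<otimes>\<^bsub>free_group S\<^esub> v \<otimes>\<^bsub>free_group S\<^esub> w
      = u \<otimes>\<^bsub>free_group S\<^esub> (v \<otimes>\<^bsub>free_group S\<^esub> w)"
    using w by (simp add: foldr_prepend_assoc)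
  show "\<exists>y\<in>carrier (free_group S). y \<otimes>\<^bsub>free_group S\<^esub> u = \<one>\<^bsub>free_group S\<^esub>"
    using u by (intro bexI[of _ "inv_word u"]) (simp_all add: foldr_prepend_inv_word freely_reduced_inv_word)
qed simp_all

lemma inv_free_group:
  assumes "w \<in> carrier (free_group S)"
  shows "inv\<^bsub>free_group S\<^esub> w = inv_word w"
  using assms
  by (intro group.inv_equality[OF group_free_group])
     (simp_all add: foldr_prepend_inv_word freely_reduced_inv_word)

lemma gen_in_free_group: "x \<in> S \<Longrightarrow> gen x \<in> carrier (free_group S)"
  by (simp add: gen_def freely_reduced_Cons)

definition word_eval :: "('a, 'b) monoid_scheme \<Rightarrow> ('g \<Rightarrow> 'a) \<Rightarrow> ('g \<times> bool) list \<Rightarrow> 'a" where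
  "word_eval G f W = foldr (\<lambda>(x, e) y. (if e then f x else inv\<^bsub>G\<^esub> f x) \<otimes>\<^bsub>G\<^esub> y) W \<one>\<^bsub>G\<^esub>"

lemma word_eval_simps [simp]:
  "word_eval G f [] = \<one>\<^bsub>G\<^esub>"
  "word_eval G f ((x, e) # W) = (if e then f x else inv\<^bsub>G\<^esub> f x) \<otimes>\<^bsub>G\<^esub> word_eval G f W"
  by (simp_all add: word_eval_def)

lemma word_eval_map: "word_eval G f (map (apfst h) W) = word_eval G (f \<circ> h) W"
  by (induction W) auto

lemma word_eval_cong:
  "(\<And>x. x \<in> fst ` set W \<Longrightarrow> f x = g x) \<Longrightarrow> word_eval G f W = word_eval G g W"
  by (induction W) auto

context group
begin

lemma word_eval_closed [simp, intro]:
  "f ` fst ` set W \<subseteq> carrier G \<Longrightarrow> word_eval G f W \<in> carrier G"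
  by (induction W) auto

lemma word_eval_prepend:
  assumes "f ` fst ` set (l # w) \<subseteq> carrier G"
  shows "word_eval G f (prepend_letter l w) = word_eval G f [l] \<otimes> word_eval G f w"
proof (cases w)
  case Nil
  with assms show ?thesis by (cases l) auto
next
  case (Cons k w')
  have w': "word_eval G f w' \<in> carrier G" using assms Cons by auto
  show ?thesis
  proof (cases "k = inv_letter l")
    case True
    then show ?thesis using assms Cons w'
      by (cases l) (auto simp: prepend_letter_Cons inv_letter_def m_assoc[symmetric])
  next
    case False
    then show ?thesis using assms Cons w'
      by (cases l) (auto simp: prepend_letter_Cons)
  qed
qed

lemma word_eval_foldr_prepend:
  assumes "f ` fst ` set u \<subseteq> carrier G" "f ` fst ` set v \<subseteq> carrier G"
  shows "word_eval G f (foldr prepend_letter u v) = word_eval G f u \<otimes> word_eval G f v"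
  using assms(1)
proof (induction u)
  case Nil
  then show ?case using assms(2) by simp
next
  case (Cons l u)
  have "f ` fst ` set (l # foldr prepend_letter u v) \<subseteq> carrier G"
    using Cons.prems assms(2) image_mono[OF set_foldr_prepend[of u v], of f]
    by (simp add: image_Un) (meson le_sup_iff order_trans)
  from word_eval_prepend[OF this] Cons show ?case
    using assms(2) by (cases l) (auto simp: m_assoc)
qed

lemma word_eval_hom:
  assumes "f ` S \<subseteq> carrier G"
  shows "word_eval G f \<in> hom (free_group S) G"
proof (rule homI)
  fix u v assume "u \<in> carrier (free_group S)" "v \<in> carrier (free_group S)"
  then have "f ` fst ` set u \<subseteq> carrier G" "f ` fst ` set v \<subseteq> carrier G"
    using assms image_mono[of "fst ` set u" S f] image_mono[of "fst ` set v" S f] by simp_all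
  then show "word_eval G f u \<in> carrier G"
    "word_eval G f (u \<otimes>\<^bsub>free_group S\<^esub> v) = word_eval G f u \<otimes> word_eval G f v"
    by (auto simp: word_eval_foldr_prepend)
qed

lemma hom_eq_word_eval:
  assumes h: "h \<in> hom (free_group S) G" and w: "w \<in> carrier (free_group S)"
  shows "h w = word_eval G (h \<circ> gen) w"
proof -
  interpret h: group_hom "free_group S" G h
    using h group_free_group by (simp add: group_hom_def group_hom_axioms_def is_group)
  show ?thesis using w
  proof (induction w)
    case Nil
    show ?case using h.hom_one by simp
  next
    case (Cons l w)
    obtain x e where l: "l = (x, e)" by (cases l)
    have w: "w \<in> carrier (free_group S)" and x: "gen x \<in> carrier (free_group S)"
      using Cons.prems l by (auto simp: freely_reduced_Cons gen_def)
    have l': "[l] \<in> carrier (free_group S)" using Cons.prems by (auto simp: freely_reduced_Cons)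
    have "h (l # w) = h ([l] \<otimes>\<^bsub>free_group S\<^esub> w)"
      using Cons.prems by (simp add: prepend_letter_reduced)
    also have "\<dots> = h [l] \<otimes> h w" using l' w by (rule h.hom_mult)
    also have "h [l] = (if e then h (gen x) else inv h (gen x))"
      using h.hom_inv[OF x] inv_free_group[OF x] by (simp add: l gen_def inv_letter_def)
    finally show ?case using Cons.IH[OF w] l by simp
  qed
qed

end

section \<open>Left multiplication, normal closures and isolation\<close>

text \<open>Outside the carrier the map is the identity, so that it is a permutation of the whole type and identities
  between such maps hold without side conditions.\<close>

definition left_mult :: "('a, 'b) monoid_scheme \<Rightarrow> 'a \<Rightarrow> 'a \<Rightarrow> 'a" where
  "left_mult G x y = (if y \<in> carrier G then x \<otimes>\<^bsub>G\<^esub> y else y)"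

lemma normal_normal_closure:
  assumes "group G" "R \<subseteq> carrier G"
  shows "normal_closure G R \<lhd> G" "R \<subseteq> normal_closure G R"
proof -
  interpret group G by fact
  have N: "carrier G \<lhd> G" by (simp add: normal_inv_iff subgroup_self)
  have "subgroup (normal_closure G R) G"
    unfolding normal_closure_def using N assms(2)
    by (intro subgroups_Inter) (auto dest: normal_imp_subgroup)
  then show "normal_closure G R \<lhd> G"
    unfolding normal_inv_iff normal_closure_def by (auto simp: normal.inv_op_closed2)
  show "R \<subseteq> normal_closure G R" by (auto simp: normal_closure_def)
qed

lemma normal_closure_subset: "N \<lhd> G \<Longrightarrow> R \<subseteq> N \<Longrightarrow> normal_closure G R \<subseteq> N"
  by (auto simp: normal_closure_def)

lemma (in group) coset_eq_one_iff:
  assumes "N \<lhd> G" "x \<in> carrier G"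
  shows "N #> x = \<one>\<^bsub>G Mod N\<^esub> \<longleftrightarrow> x \<in> N"
  using assms coset_join1[of N x] coset_join2[of x N] normal_imp_subgroup[of N G]
  by (auto simp: FactGroup_def)

text \<open>In the product topology the conditions that finitely many elements belong or do not belong to a subgroup
  define an open set.\<close>

lemma isolated_singleton:
  fixes G (structure)
  assumes "group G" "finite R" "R \<subseteq> carrier G" "z \<in> carrier G" and N: "N \<lhd> G"
    and "R \<subseteq> N" "z \<notin> N"
    and unique: "\<And>M. M \<lhd> G \<Longrightarrow> R \<subseteq> M \<Longrightarrow> z \<notin> M \<Longrightarrow> M = N"
  shows "openin (normal_subgroup_topology G) {N}"
proof -
  let ?X = "\<lambda>x. if x = z then {False} else if x \<in> R then {True} else UNIV"
  let ?U = "PiE (carrier G) ?X"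
  have "{x. ?X x \<noteq> UNIV} \<subseteq> insert z R" by auto
  then have fin: "finite {x. ?X x \<noteq> UNIV}"
    using assms(2) by (rule finite_subset[OF _ finite.insertI])
  have "openin (product_topology (\<lambda>_. discrete_topology UNIV) (carrier G)) ?U"
  proof (rule product_topology_basis)
    show "finite {x. ?X x \<noteq> topspace (discrete_topology UNIV)}"
      using fin by (simp only: topspace_discrete_topology)
  qed simp
  moreover have "{N} = (\<lambda>N. \<lambda>x \<in> carrier G. x \<in> N) -` ?U \<inter> {N. N \<lhd> G}"
  proof -
    have "(\<lambda>x \<in> carrier G. x \<in> M) \<in> ?U \<longleftrightarrow> R \<subseteq> M \<and> z \<notin> M" for M
    proof -
      have "(\<lambda>x \<in> carrier G. x \<in> M) \<in> ?U \<longleftrightarrow> (\<forall>x\<in>carrier G. (x \<in> M) \<in> ?X x)"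
        by (simp add: PiE_iff)
      also have "\<dots> \<longleftrightarrow> R \<subseteq> M \<and> z \<notin> M"
        using assms(3,4,6,7) by (auto split: if_splits)
      finally show ?thesis .
    qed
    then have "(\<lambda>N. \<lambda>x \<in> carrier G. x \<in> N) -` ?U \<inter> {N. N \<lhd> G} = {M. M \<lhd> G \<and> R \<subseteq> M \<and> z \<notin> M}"
      unfolding vimage_def Int_def mem_Collect_eq by blast
    also have "\<dots> = {N}" using N assms(6,7) unique by blast
    finally show ?thesis by (rule sym)
  qed
  ultimately show ?thesis
    unfolding normal_subgroup_topology_def openin_pullback_topology by blast
qed


section \<open>The finitely presented Grigorchuk group\<close>

text \<open>For each relation, the reduced word for its left side times the inverse of its right side.\<close>

definition relators :: "(grigorchuk_generator \<times> bool) list list" where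
  "relators =
    (let p = \<lambda>x. (x, True); n = \<lambda>x. (x, False) in
     [[p GA, p GA], [p GB, p GB], [p GB, p GC, p GD],
      concat (replicate 4 [p GA, p GD]),
      concat (replicate 4 [p GA, p GD, p GA, p GC, p GA, p GC]),
      [n GT, p GA, p GT, n GA, n GC, n GA],
      [n GT, p GB, p GT, n GD], [n GT, p GC, p GT, n GB], [n GT, p GD, p GT, n GC]])"

lemma grigorchuk_relators:
  "{u \<otimes>\<^bsub>free_group UNIV\<^esub> inv\<^bsub>free_group UNIV\<^esub> v | u v. (u, v) \<in> grigorchuk_relations} = set relators"
proof -
  let ?F = "free_group (UNIV :: grigorchuk_generator set)"
  have inv: "inv\<^bsub>?F\<^esub> w = inv_word w" if "freely_reduced w" for w
    using that by (intro inv_free_group) simp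
  have "{u \<otimes>\<^bsub>?F\<^esub> inv\<^bsub>?F\<^esub> v | u v. (u, v) \<in> grigorchuk_relations} =
      (\<lambda>(u, v). u \<otimes>\<^bsub>?F\<^esub> inv\<^bsub>?F\<^esub> v) ` grigorchuk_relations"
    by auto
  also have "\<dots> = set relators"
    by (simp add: grigorchuk_relations_def relators_def Let_def gen_def inv numeral_eq_Suc
        freely_reduced_Cons prepend_letter_Cons inv_letter_def nat_pow_def)
  finally show ?thesis .
qed

locale grigorchuk_relator_group = group G for G (structure) +
  fixes f :: "grigorchuk_generator \<Rightarrow> 'a"
  assumes f_closed [simp]: "f x \<in> carrier G"
    and relators: "r \<in> set relators \<Longrightarrow> word_eval G f r = \<one>"
begin

lemma word_eval_in_carrier [simp]: "word_eval G f W \<in> carrier G"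
  by (rule word_eval_closed) auto

lemma left_mult_word_eval:
  "foldr (\<lambda>(x, e). left_mult G (if e then f x else inv f x)) W y = left_mult G (word_eval G f W) y"
proof (induction W)
  case (Cons l W)
  then show ?case by (cases l) (simp add: left_mult_def m_assoc)
qed (simp add: left_mult_def)

lemma left_mult_inv [simp]:
  "left_mult G (inv f x) (left_mult G (f x) y) = y" "left_mult G (f x) (left_mult G (inv f x) y) = y"
  by (simp_all add: left_mult_def flip: m_assoc)

lemma relator_action:
  assumes "r \<in> set relators"
  shows "foldr (\<lambda>(x, e). left_mult G (if e then f x else inv f x)) r y = y"
  unfolding left_mult_word_eval relators[OF assms] by (simp add: left_mult_def)

sublocale relation_model "left_mult G (f GA)" "left_mult G (f GB)" "left_mult G (f GC)"
  "left_mult G (f GD)" "left_mult G (f GT)" "left_mult G (inv f GT)"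
proof
  let ?l = "\<lambda>x. left_mult G (f x)" and ?i = "\<lambda>x. left_mult G (inv f x)"
  have rel: "foldr (\<lambda>(x, e). left_mult G (if e then f x else inv f x)) (relators ! n) y = y"
    if "n < 9" for n y
    using that by (intro relator_action nth_mem) (simp add: relators_def Let_def)
  note rels = rel[unfolded relators_def Let_def]
  fix y
  show "?l GA (?l GA y) = y" using rels[of 0 y] by simp
  show "?l GB (?l GB y) = y" using rels[of 1 y] by simp
  show "?l GB (?l GC (?l GD y)) = y" using rels[of 2 y] by simp
  show "?l GA (?l GD (?l GA (?l GD (?l GA (?l GD (?l GA (?l GD y))))))) = y"
    using rels[of 3 y] by (simp add: numeral_eq_Suc)
  show "?l GA (?l GD (?l GA (?l GC (?l GA (?l GC (?l GA (?l GD (?l GA (?l GC (?l GA (?l GC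
      (?l GA (?l GD (?l GA (?l GC (?l GA (?l GC (?l GA (?l GD (?l GA (?l GC (?l GA (?l GC y)
      )))))))))))))))))))))) = y"
    using rels[of 4 y] by (simp add: numeral_eq_Suc)
  show "?l GT (?i GT y) = y" "?i GT (?l GT y) = y" by simp_all
  show "?i GT (?l GA (?l GT y)) = ?l GA (?l GC (?l GA y))"
    using rels[of 5 "?l GA (?l GC (?l GA y))"] by simp
  show "?i GT (?l GB (?l GT y)) = ?l GD y" using rels[of 6 "?l GD y"] by simp
  show "?i GT (?l GC (?l GT y)) = ?l GB y" using rels[of 7 "?l GB y"] by simp
  show "?i GT (?l GD (?l GT y)) = ?l GC y" using rels[of 8 "?l GC y"] by simp
qed

lemma act_eq: "act W y = left_mult G (word_eval G f W) y"
proof -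
  have self_inv: "left_mult G (inv f x) = left_mult G (f x)" if "x \<noteq> GT" for x
  proof
    fix y
    have "left_mult G (f x) (left_mult G (f x) y) = y" using that by (cases x) simp_all
    then show "left_mult G (inv f x) y = left_mult G (f x) y" by (metis left_mult_inv(1))
  qed
  have "act W y = foldr (\<lambda>(x, e). left_mult G (if e then f x else inv f x)) W y"
  proof (induction W)
    case (Cons l W)
    obtain x e where "l = (x, e)" by (cases l)
    with Cons show ?case by (cases x) (auto simp: self_inv)
  qed simp
  then show ?thesis by (simp add: left_mult_word_eval)
qed

lemma act_trivial_iff: "(\<forall>y. act W y = y) \<longleftrightarrow> word_eval G f W = \<one>"
proof
  assume "\<forall>y. act W y = y"
  then have "act W \<one> = \<one>" by blast
  then show "word_eval G f W = \<one>" by (simp add: act_eq left_mult_def)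
qed (simp add: act_eq left_mult_def)

end

text \<open>The commutator of the two witnesses. As these are products of involutions, reversal inverts them.\<close>

definition discriminator :: "(grigorchuk_generator \<times> bool) list" where
  "discriminator =
    map (\<lambda>l. (case l of LA \<Rightarrow> GA | LB \<Rightarrow> GB | LC \<Rightarrow> GC | LD \<Rightarrow> GD, True))
      (witness_left @ witness_right @ rev witness_left @ rev witness_right)"

lemma (in relation_model) act_discriminator:
  "(\<forall>x. act discriminator x = x) \<longleftrightarrow> ev (witness_left @ witness_right) = ev (witness_right @ witness_left)"
proof -
  have "act (map (\<lambda>l. (case l of LA \<Rightarrow> GA | LB \<Rightarrow> GB | LC \<Rightarrow> GC | LD \<Rightarrow> GD, True)) w) x = ev w x" for w x
  proof (induction w)
    case (Cons l w)
    then show ?case by (cases l) simp_all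
  qed simp
  then have "act discriminator x = ev witness_left (ev witness_right (ev (rev witness_left) (ev (rev witness_right) x)))" for x
    by (simp add: discriminator_def del: map_append)
  moreover have "(\<forall>x. ev witness_left (ev witness_right (ev (rev witness_left) (ev (rev witness_right) x))) = x) \<longleftrightarrow>
      (\<forall>x. ev witness_left (ev witness_right x) = ev witness_right (ev witness_left x))"
    by (metis ev_rev)
  ultimately show ?thesis by (simp add: fun_eq_iff)
qed

text \<open>Two groups satisfying the relations in which the discriminator is nontrivial thus have the same relations, by
  applying this in both directions.\<close>

lemma word_eval_transfer:
  assumes "grigorchuk_relator_group G f" "grigorchuk_relator_group H g"
    and "word_eval G f discriminator \<noteq> \<one>\<^bsub>G\<^esub>" and "word_eval G f W = \<one>\<^bsub>G\<^esub>"
  shows "word_eval H g W = \<one>\<^bsub>H\<^esub>"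
proof -
  interpret G: grigorchuk_relator_group G f by fact
  interpret H: grigorchuk_relator_group H g by fact
  have "G.ev (witness_left @ witness_right) \<noteq> G.ev (witness_right @ witness_left)"
    using assms(3) G.act_discriminator G.act_trivial_iff[of discriminator] by blast
  moreover have "G.act W y = y" for y
    using assms(4) G.act_trivial_iff[of W] by blast
  ultimately have "H.act W y = y" for y
    by (rule G.trivial_transfer[OF _ _ H.relation_model_axioms])
  then show ?thesis using H.act_trivial_iff by blast
qed

abbreviation relator_closure :: "(grigorchuk_generator \<times> bool) list set" where
  "relator_closure \<equiv> normal_closure (free_group UNIV) (set relators)"

lemma grigorchuk_fp_group_eq: "grigorchuk_fp_group = free_group UNIV Mod relator_closure"
  by (simp add: grigorchuk_fp_group_def presented_group_def grigorchuk_relators del: free_group_simps)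

lemma relators_in_free_group: "set relators \<subseteq> carrier (free_group UNIV)"
  by (simp add: relators_def Let_def freely_reduced_Cons inv_letter_def numeral_eq_Suc)

lemma relator_closure_normal: "relator_closure \<lhd> free_group UNIV"
  and relators_subset_closure: "set relators \<subseteq> relator_closure"
  using normal_normal_closure[OF group_free_group relators_in_free_group] by blast+

lemma group_grigorchuk: "group grigorchuk_fp_group"
  unfolding grigorchuk_fp_group_eq by (rule normal.factorgroup_is_group[OF relator_closure_normal])

definition grig_gen :: "grigorchuk_generator \<Rightarrow> (grigorchuk_generator \<times> bool) list set" where
  "grig_gen x = relator_closure #>\<^bsub>free_group UNIV\<^esub> gen x"

lemma grig_coset:
  assumes "W \<in> carrier (free_group UNIV)"
  shows "relator_closure #>\<^bsub>free_group UNIV\<^esub> W = word_eval grigorchuk_fp_group grig_gen W"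
  using group.hom_eq_word_eval[OF group_grigorchuk, of "\<lambda>W. relator_closure #>\<^bsub>free_group UNIV\<^esub> W", OF _ assms]
    normal.r_coset_hom_Mod[OF relator_closure_normal]
  unfolding grigorchuk_fp_group_eq grig_gen_def comp_def by blast

lemma grig_word_eval_eq_one_iff:
  assumes "W \<in> carrier (free_group UNIV)"
  shows "word_eval grigorchuk_fp_group grig_gen W = \<one>\<^bsub>grigorchuk_fp_group\<^esub> \<longleftrightarrow> W \<in> relator_closure"
  using group.coset_eq_one_iff[OF group_free_group relator_closure_normal assms]
  unfolding grig_coset[OF assms] grigorchuk_fp_group_eq .

lemma grig_gen_closed: "grig_gen x \<in> carrier grigorchuk_fp_group"
  unfolding grig_gen_def grigorchuk_fp_group_eq
  using gen_in_free_group[of x UNIV] by (auto simp: FactGroup_def RCOSETS_def simp del: free_group_simps)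

interpretation grig: grigorchuk_relator_group grigorchuk_fp_group grig_gen
proof (intro grigorchuk_relator_group.intro grigorchuk_relator_group_axioms.intro group_grigorchuk)
  fix r assume "r \<in> set relators"
  then show "word_eval grigorchuk_fp_group grig_gen r = \<one>\<^bsub>grigorchuk_fp_group\<^esub>"
    using grig_word_eval_eq_one_iff[of r] relators_subset_closure relators_in_free_group by blast
qed (rule grig_gen_closed)

lemma grig_surj: "x \<in> carrier grigorchuk_fp_group \<Longrightarrow>
    \<exists>W \<in> carrier (free_group UNIV). x = word_eval grigorchuk_fp_group grig_gen W"
  using grig_coset unfolding grigorchuk_fp_group_eq by (auto simp: FactGroup_def RCOSETS_def simp del: free_group_simps)

lemma (in relation_model) act_relator: "r \<in> set relators \<Longrightarrow> act r x = x"
  using ad4 adacac4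
  by (auto simp: relators_def Let_def numeral_eq_Suc conj_a conj_b conj_c conj_d bcd)

lemma (in relation_model) generator_action_inv_letter:
  "generator_action (inv_letter l) (generator_action l x) = x"
proof -
  obtain y e where "l = (y, e)" by (cases l)
  then show ?thesis by (cases y; cases e) (simp_all add: inv_letter_def)
qed

text \<open>The normal closure of the relators lies in this kernel, so a word that acts nontrivially in some model is
  nontrivial in the presented group.\<close>

lemma (in relation_model) normal_act_kernel: "{W \<in> carrier (free_group UNIV). \<forall>x. act W x = x} \<lhd> free_group UNIV"
  (is "?N \<lhd> ?F")
proof -
  interpret F: group ?F by (rule group_free_group)
  have prepend: "act (prepend_letter l w) x = generator_action l (act w x)" for l w x
    using generator_action_inv_letter[of "inv_letter l"]
    by (cases w) (auto simp: prepend_letter_Cons)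
  have mult: "act (u \<otimes>\<^bsub>?F\<^esub> v) x = act u (act v x)" for u v x
    by (induction u) (simp_all add: prepend)
  have inv: "act (inv\<^bsub>?F\<^esub> w) (act w x) = x" "act w (act (inv\<^bsub>?F\<^esub> w) x) = x" if "w \<in> carrier ?F" for w x
    using mult[of "inv\<^bsub>?F\<^esub> w" w x] mult[of w "inv\<^bsub>?F\<^esub> w" x] F.l_inv[OF that] F.r_inv[OF that] by simp_all
  show ?thesis
    unfolding F.normal_inv_iff
  proof (intro conjI ballI)
    show "subgroup ?N ?F"
    proof (rule F.subgroupI)
      show "?N \<noteq> {}" using F.one_closed by (auto intro!: exI[of _ "[]"])
      fix w assume w: "w \<in> ?N"
      then have "w \<in> carrier ?F" and triv: "act w x = x" for x by blast+
      then have "act (inv\<^bsub>?F\<^esub> w) x = x" for x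
        using inv(1)[of w x] by simp
      then show "inv\<^bsub>?F\<^esub> w \<in> ?N"
        using F.inv_closed[OF \<open>w \<in> carrier ?F\<close>] by blast
    next
      fix u v assume "u \<in> ?N" "v \<in> ?N"
      then show "u \<otimes>\<^bsub>?F\<^esub> v \<in> ?N" using mult[of u v] F.m_closed[of u v] by (simp del: free_group_simps)
    qed auto
    fix u w assume u: "u \<in> carrier ?F" and w: "w \<in> ?N"
    have "act (u \<otimes>\<^bsub>?F\<^esub> w \<otimes>\<^bsub>?F\<^esub> inv\<^bsub>?F\<^esub> u) x = x" for x
      using w inv(2)[OF u] by (simp add: mult del: free_group_simps)
    then show "u \<otimes>\<^bsub>?F\<^esub> w \<otimes>\<^bsub>?F\<^esub> inv\<^bsub>?F\<^esub> u \<in> ?N"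
      using u w by (simp del: free_group_simps)
  qed
qed

lemma discriminator_in_free_group: "discriminator \<in> carrier (free_group UNIV)"
  by (simp add: discriminator_def witness_left_def witness_right_def freely_reduced_Cons inv_letter_def)

lemma discriminator_nontrivial:
  "word_eval grigorchuk_fp_group grig_gen discriminator \<noteq> \<one>\<^bsub>grigorchuk_fp_group\<^esub>"
proof
  assume "word_eval grigorchuk_fp_group grig_gen discriminator = \<one>\<^bsub>grigorchuk_fp_group\<^esub>"
  then have "discriminator \<in> relator_closure"
    using grig_word_eval_eq_one_iff[OF discriminator_in_free_group] by blast
  moreover have "set relators \<subseteq> {W \<in> carrier (free_group UNIV). \<forall>x. extended.act W x = x}"
    using relators_in_free_group extended.act_relator by blast
  ultimately have "\<forall>x. extended.act discriminator x = x"
    using normal_closure_subset[OF extended.normal_act_kernel] by blast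
  then show False using extended.act_discriminator extended_witnesses by blast
qed

text \<open>The topology is defined for free groups on initial segments of the natural numbers, so the generators are
  numbered.\<close>

fun generator_number :: "grigorchuk_generator \<Rightarrow> nat" where
  "generator_number GA = 0"
| "generator_number GB = 1"
| "generator_number GC = 2"
| "generator_number GD = 3"
| "generator_number GT = 4"

definition number_generator :: "nat \<Rightarrow> grigorchuk_generator" where
  "number_generator n = (if n = 0 then GA else if n = 1 then GB else if n = 2 then GC
     else if n = 3 then GD else GT)"

lemma number_generator_number [simp]: "number_generator (generator_number x) = x"
  by (cases x) (simp_all add: number_generator_def)

lemma generator_number_generator: "n < 5 \<Longrightarrow> generator_number (number_generator n) = n"
  by (auto simp: number_generator_def)

lemma generator_number_less: "generator_number x < 5"
  by (cases x) auto

abbreviation renumber :: "(grigorchuk_generator \<times> bool) list \<Rightarrow> (nat \<times> bool) list" where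
  "renumber \<equiv> map (apfst generator_number)"

lemma renumber_in_free_group:
  assumes "W \<in> carrier (free_group UNIV)"
  shows "renumber W \<in> carrier (free_group {..<5})"
proof -
  have "(apfst generator_number l = inv_letter (apfst generator_number k)) = (l = inv_letter k)" for k l
    by (cases k; cases l) (metis apfst_conv fst_conv inv_letter_def number_generator_number snd_conv)
  then show ?thesis using assms
    by (auto simp: freely_reduced_def successively_map generator_number_less)
qed

lemma word_eval_renumber:
  "word_eval G (f \<circ> number_generator) (renumber W) = word_eval G f W"
  by (simp add: word_eval_map comp_def)

theorem proposition5p18:
  shows "isolated_group grigorchuk_fp_group"
proof -
  let ?G = grigorchuk_fp_group and ?F = "free_group {..<5 :: nat}"
  let ?h = "word_eval ?G (grig_gen \<circ> number_generator)"
  let ?N = "kernel ?F ?G ?h"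
  interpret F: group ?F by (rule group_free_group)
  have "?h \<in> hom ?F ?G"
    using grig_gen_closed by (intro grig.word_eval_hom) (simp add: image_subset_iff)
  then have hom: "group_hom ?F ?G ?h"
    unfolding group_hom_def group_hom_axioms_def using group_grigorchuk F.is_group by blast
  have "carrier ?G \<subseteq> ?h ` carrier ?F"
  proof
    fix x assume "x \<in> carrier ?G"
    then obtain W where W: "W \<in> carrier (free_group UNIV)" "x = word_eval ?G grig_gen W"
      using grig_surj by blast
    then have "x = ?h (renumber W)" by (simp add: word_eval_renumber)
    then show "x \<in> ?h ` carrier ?F"
      using renumber_in_free_group[OF W(1)] by (rule image_eqI)
  qed
  then have surj: "?h ` carrier ?F = carrier ?G" using group_hom.hom_closed[OF hom] by blast
  have "(?F Mod ?N) \<cong> ?G" using group_hom.FactGroup_iso_set[OF hom surj] by (rule is_isoI)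
  moreover have "openin (marked_groups 5) {?N}"
    unfolding marked_groups_def
  proof (rule isolated_singleton)
    show "finite (renumber ` set relators)" by simp
    show rel: "renumber ` set relators \<subseteq> carrier ?F" and z: "renumber discriminator \<in> carrier ?F"
      using relators_in_free_group discriminator_in_free_group renumber_in_free_group by blast+
    show "renumber ` set relators \<subseteq> ?N" "renumber discriminator \<notin> ?N"
      using rel z grig.relators discriminator_nontrivial
      by (auto simp: kernel_def word_eval_renumber simp del: free_group_simps)
    fix M assume M: "M \<lhd> ?F" and rel_M: "renumber ` set relators \<subseteq> M"
      and z_M: "renumber discriminator \<notin> M"
    let ?Q = "?F Mod M"
    let ?g = "\<lambda>x. M #>\<^bsub>?F\<^esub> gen (generator_number x)"
    \<comment> \<open>The quotient by \<open>M\<close> satisfies the relations, and the discriminator is nontrivial in it, so that it has the same relations as the given group.\<close>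
    interpret Q: group ?Q by (rule normal.factorgroup_is_group[OF M])
    have coset: "M #>\<^bsub>?F\<^esub> W = word_eval ?Q (?g \<circ> number_generator) W" if "W \<in> carrier ?F" for W
    proof -
      have "M #>\<^bsub>?F\<^esub> W = word_eval ?Q ((\<lambda>W. M #>\<^bsub>?F\<^esub> W) \<circ> gen) W"
        by (rule Q.hom_eq_word_eval[OF normal.r_coset_hom_Mod[OF M] that])
      also have "\<dots> = word_eval ?Q (?g \<circ> number_generator) W"
        using that by (intro word_eval_cong) (auto simp: generator_number_generator)
      finally show ?thesis .
    qed
    have in_M: "W \<in> M \<longleftrightarrow> word_eval ?Q (?g \<circ> number_generator) W = \<one>\<^bsub>?Q\<^esub>" if "W \<in> carrier ?F" for W
      using F.coset_eq_one_iff[OF M that] coset[OF that] by simp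
    have gQ: "grigorchuk_relator_group ?Q ?g"
    proof (intro grigorchuk_relator_group.intro grigorchuk_relator_group_axioms.intro Q.is_group)
      show "?g x \<in> carrier ?Q" for x
        using gen_in_free_group[of "generator_number x" "{..<5}"]
        by (auto simp: FactGroup_def RCOSETS_def generator_number_less simp del: free_group_simps)
      fix r assume "r \<in> set relators"
      then have "renumber r \<in> carrier ?F" "renumber r \<in> M" using rel rel_M by blast+
      then show "word_eval ?Q ?g r = \<one>\<^bsub>?Q\<^esub>"
        using in_M by (simp only: word_eval_renumber)
    qed
    have zQ: "word_eval ?Q ?g discriminator \<noteq> \<one>\<^bsub>?Q\<^esub>"
      using in_M[OF z] z_M unfolding word_eval_renumber by blast
    have "W \<in> M \<longleftrightarrow> W \<in> ?N" if W: "W \<in> carrier ?F" for W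
    proof -
      let ?W = "map (apfst number_generator) W"
      have "W \<in> M \<longleftrightarrow> word_eval ?Q ?g ?W = \<one>\<^bsub>?Q\<^esub>"
        using in_M[OF W] by (simp add: word_eval_map)
      also have "\<dots> \<longleftrightarrow> word_eval ?G grig_gen ?W = \<one>\<^bsub>?G\<^esub>"
        using word_eval_transfer[OF gQ grig.grigorchuk_relator_group_axioms zQ]
          word_eval_transfer[OF grig.grigorchuk_relator_group_axioms gQ discriminator_nontrivial] by blast
      also have "\<dots> \<longleftrightarrow> W \<in> ?N" using W by (simp add: kernel_def word_eval_map)
      finally show ?thesis .
    qed
    moreover have "M \<subseteq> carrier ?F" using normal_imp_subgroup[OF M] by (rule subgroup.subset)
    moreover have "?N \<subseteq> carrier ?F" unfolding kernel_def by blast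
    ultimately show "M = ?N" by blast
  qed (use F.is_group group_hom.normal_kernel[OF hom] in blast)+
  moreover have "finitely_generated_group ?G"
  proof -
    have "word_eval ?G grig_gen W \<in> generate ?G (range grig_gen)" for W
      by (induction W) (auto intro!: generate.eng generate.incl[OF rangeI] generate.inv[OF rangeI] generate.one)
    then have gen: "generate ?G (range grig_gen) = carrier ?G"
      using grig.generate_incl[of "range grig_gen"] grig_surj grig_gen_closed
      by (metis image_subsetI subsetI subset_antisym)
    have "finite (UNIV :: grigorchuk_generator set)"
    proof -
      have "(UNIV :: grigorchuk_generator set) \<subseteq> {GA, GB, GC, GD, GT}"
        using grigorchuk_generator.exhaust by blast
      then show ?thesis by (rule finite_subset) simp
    qed
    then have "finite (range grig_gen)" by (rule finite_imageI)
    moreover have "range grig_gen \<subseteq> carrier ?G" using grig_gen_closed by blast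
    ultimately show ?thesis unfolding finitely_generated_group_def
      using group_grigorchuk gen by blast
  qed
  ultimately show ?thesis
    unfolding isolated_group_def using group_hom.normal_kernel[OF hom] by blast
qed

end
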